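(* The five sets of V-arithmetic graphs $\Gamma^{(6)}_1(14)$, $\Gamma^{(6)}_2(14)$, $\Gamma^{(6)}_3(14)$, $\Gamma^{(7)}_1(14)$, $\Gamma^{(7)}_2(14)$ (defined in the context; graphs are considered up to isomorphism of weighted graphs, i.e. up to their Gram matrices) and the five sets of their ground fields $\mathcal F\Gamma^{(6)}_1(14)$, $\mathcal F\Gamma^{(6)}_2(14)$, $\mathcal F\Gamma^{(6)}_3(14)$, $\mathcal F\Gamma^{(7)}_1(14)$, $\mathcal F\Gamma^{(7)}_2(14)$ are finite. Moreover: (1) every field $\mathbb K\in\mathcal F\Gamma^{(6)}_1(14)$ satisfies $[\mathbb K:\mathbb Q]\le 56$; (2) every field $\mathbb K\in\mathcal F\Gamma^{(6)}_2(14)$ satisfies $[\mathbb K:\mathbb Q]\le 75$; (3) every field $\mathbb K\in\mathcal F\Gamma^{(6)}_3(14)$ satisfies $[\mathbb K:\mathbb Q]\le 138$; (4) every field $\mathbb K\in\mathcal F\Gamma^{(7)}_1(14)$ satisfies $[\mathbb K:\mathbb Q]\le 42$; (5) every field $\mathbb K\in\mathcal F\Gamma^{(7)}_2(14)$ satisfies $[\mathbb K:\mathbb Q]\le 138$.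
   Context: **Chambers and Gram matrices.** Let $V$ be a real vector space with a symmetric bilinear form $x\cdot y$ of signature $(1,n)$ (one positive, $n$ negative squares); hyperbolic $n$-space is the set of rays in one half of the cone $\{x : x\cdot x>0\}$. A vector $\delta\in V$ with $\delta\cdot\delta=-2$ defines the hyperplane $\mathcal H_\delta=\{x : x\cdot\delta=0\}$ and the half-space $\{x : x\cdot\delta\ge 0\}$. A *fundamental chamber* $\mathcal M$ of dimension $n$ is the non-degenerate locally finite polyhedron $\{x : x\cdot\delta\ge0\ \forall\,\delta\in P(\mathcal M)\}$, where $P(\mathcal M)$ is the set of vectors of square $-2$ perpendicular to the codimension one faces and directed outwards, such that for distinct $\delta,\delta'\in P(\mathcal M)$ either $\delta\cdot\delta'=2\cos(\pi/m)$ with an integer $m\ge 2$ (the hyperplanes meet at angle $\pi/m$) or $\delta\cdot\delta'\ge2$. Non-degenerate means that $P(\mathcal M)$ generates $V$, i.e. the Gram matrix $A=(\delta\cdot\delta')_{\delta,\delta'\in P(\mathcal M)}$ has signature $(1,n)$ (and rank $n+1$). Finite volume is not required. The *Gram graph* $\Gamma(P(\mathcal M))$ is the graph with vertex set $P(\mathcal M)$, in which distinct $\delta,\delta'$ are joined when $\delta\cdot\delta'\neq0$, weighted by $\delta\cdot\delta'$. **V-arithmeticity and ground field.** Let $A=(a_{ij})$ be the (finite) Gram matrix of $\mathcal M$, let $\widetilde{\mathbb K}=\mathbb Q(a_{ij})$, and let $\mathbb K\subset\mathbb R$ be the field generated over $\mathbb Q$ by all cyclic products $a_{i_1i_2}a_{i_2i_3}\cdots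 a_{i_{m-1}i_m}a_{i_mi_1}$. The chamber $\mathcal M$ (and its Gram graph) is *V-arithmetic* (arithmetic in the sense of Vinberg's criterion) if $\mathbb K$ and $\widetilde{\mathbb K}$ are totally real algebraic number fields, all cyclic products are algebraic integers, and for every embedding $\sigma:\widetilde{\mathbb K}\to\mathbb R$ which is not the identity on $\mathbb K$ the matrix $\sigma(A)$ is negative semi-definite. The field $\mathbb K$ is then called the *ground field*. **Minimality.** $\mathcal M$ (or its graph) has minimality $14$ if $\delta\cdot\delta'<14$ for all $\delta,\delta'\in P(\mathcal M)$. **The pentagon graphs.** In each case below, all inner products of two distinct listed vectors which are not specified are $0$, all listed vectors have square $-2$, and indices of $\delta_1,\dots,\delta_5$ are cyclic mod $5$. Put $a_{ij}=\delta_i\cdot\delta_j$. For the five non-adjacent pairs, $a_{13},a_{14},a_{24},a_{25},a_{35}$ are real numbers $>2$. - $\Gamma^{(6)}_1$: 3-dimensional, vertices $\delta_1,\dots,\delta_5,e$; $\delta_1\cdot\delta_2=2\cos(\pi/k)$ with an integer $k\ge3$; $\delta_4\cdot e=2\cos(\pi/m)$ with an integer $m\ge3$. - $\Gamma^{(6)}_2$: 3-dimensional, vertices $\delta_1,\dots,\delta_5,e$; $\delta_1\cdot e=2\cos(\pi/m)$, $m\ge3$. - $\Gamma^{(6)}_3$: 3-dimensional, vertices $\delta_1,\dots,\delta_5,e$; $\delta_1\cdot e=2\cos(\pi/m_1)$, $\delta_3\cdot e=2\cos(\pi/m_3)$, $m_1,m_3\ge3$. - $\Gamma^{(7)}_1$: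 4-dimensional, vertices $\delta_1,\dots,\delta_5,e_1,e_2$; $\delta_1\cdot e_1=2\cos(\pi/m_1)$, $\delta_2\cdot e_2=2\cos(\pi/m_2)$, $m_1,m_2\ge3$. - $\Gamma^{(7)}_2$: 4-dimensional, vertices $\delta_1,\dots,\delta_5,e_1,e_2$; $\delta_1\cdot e_1=2\cos(\pi/m_1)$, $\delta_2\cdot e_2=2\cos(\pi/m_2)$, $\delta_3\cdot e_1=2\cos(\pi/m_3)$, $m_1,m_2,m_3\ge3$. Each such graph is required (by definition) to be the Gram graph $\Gamma(P(\mathcal M))$ of a fundamental chamber $\mathcal M$ of the indicated dimension $n\in\{3,4\}$ (so its Gram matrix has signature $(1,n)$ and rank $n+1$), such that the 2-dimensional face of $\mathcal M$ lying in $\mathcal H_e$ (respectively in $\mathcal H_{e_1}\cap\mathcal H_{e_2}$) is a pentagon whose five consecutive sides are cut out by $\mathcal H_{\delta_1},\dots,\mathcal H_{\delta_5}$ in this order. For $\Gamma_1^{(6)}$ this pentagon has one angle $\pi/k$ (between the sides of $\delta_1$ and $\delta_2$) and the other four angles right; in all other cases all five angles are right. $\Gamma^{(6)}_i(14)$ ($i=1,2,3$) and $\Gamma^{(7)}_j(14)$ ($j=1,2$) denote the sets of all graphs of the corresponding type that are V-arithmetic and have minimality $14$ (so $2<a_{ij}<14$ for the five non-adjacent pairs). $\mathcal F\Gamma^{(6)}_i(14)$ and $\mathcal F\Gamma^{(7)}_j(14)$ denote the sets of their ground fields. *)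

theory Defs
  imports "HOL-Analysis.Analysis" "HOL-Algebra.Algebraic_Closure_Type"
    "HOL-Algebra.Generated_Fields"
begin

section \<open>Hyperbolic space and fundamental chambers\<close>

text \<open>
  The class \<open>euclidean_space\<close> is used for the ambient space only to have finite dimension and
  the usual topology; its inner product plays no role.  The geometry comes from the form \<open>B\<close>.
\<close>

definition lorentzian_form :: "nat \<Rightarrow> ('v::euclidean_space \<Rightarrow> 'v \<Rightarrow> real) \<Rightarrow> bool" where
  "lorentzian_form n B \<longleftrightarrow>
     bilinear B \<and> (\<forall>x y. B x y = B y x) \<and> DIM('v) = n + 1 \<and>
     (\<exists>E. independent E \<and> span E = UNIV \<and> (\<forall>x\<in>E. \<forall>y\<in>E. x \<noteq> y \<longrightarrow> B x y = 0) \<and>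
          card {x \<in> E. B x x > 0} = 1 \<and> card {x \<in> E. B x x < 0} = n)"

text \<open>
  A point of hyperbolic space is a ray in one of the two halves (connected components) of the
  cone \<open>{x. B x x > 0}\<close>.  A set of points is represented by the union of its rays, so that a
  subset of hyperbolic dimension \<open>k\<close> has affine dimension \<open>k + 1\<close>.
\<close>

definition half_cones :: "('v::euclidean_space \<Rightarrow> 'v \<Rightarrow> real) \<Rightarrow> 'v set set" where
  "half_cones B = components {x. B x x > 0}"

definition hplane :: "('v \<Rightarrow> 'v \<Rightarrow> real) \<Rightarrow> 'v \<Rightarrow> 'v set" where
  "hplane B \<delta> = {x. B x \<delta> = 0}"

text \<open>The set \<open>P(M)\<close>; the chamber lies on the side \<open>B x \<delta> \<ge> 0\<close> of each of its walls.\<close>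

definition normals :: "('v::euclidean_space \<Rightarrow> 'v \<Rightarrow> real) \<Rightarrow> 'v set \<Rightarrow> 'v set" where
  "normals B M =
     {\<delta>. B \<delta> \<delta> = -2 \<and> (\<forall>x\<in>M. 0 \<le> B x \<delta>) \<and> (M \<inter> hplane B \<delta>) facet_of M}"

definition fundamental_chamber ::
    "('v::euclidean_space \<Rightarrow> 'v \<Rightarrow> real) \<Rightarrow> 'v set \<Rightarrow> 'v set \<Rightarrow> bool" where
  "fundamental_chamber B L M \<longleftrightarrow>
     interior M \<noteq> {} \<and>
     M = {x \<in> L. \<forall>\<delta>\<in>normals B M. 0 \<le> B x \<delta>} \<and>
     (\<forall>C. compact C \<and> C \<subseteq> L \<longrightarrow> finite {\<delta> \<in> normals B M. C \<inter> hplane B \<delta> \<noteq> {}}) \<and>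
     (\<forall>\<delta>\<in>normals B M. \<forall>\<delta>'\<in>normals B M. \<delta> \<noteq> \<delta>' \<longrightarrow>
        (\<exists>m::nat. m \<ge> 2 \<and> B \<delta> \<delta>' = 2 * cos (pi / real m)) \<or> B \<delta> \<delta>' \<ge> 2) \<and>
     span (normals B M) = UNIV"

section \<open>Fields, V-arithmeticity and the ground field\<close>

abbreviation real_ring :: "real ring" where
  "real_ring \<equiv> ring_of_type_algebra"

abbreviation complex_ring :: "complex ring" where
  "complex_ring \<equiv> ring_of_type_algebra"

text \<open>The field \<open>\<rat>(S)\<close>: a subfield of \<open>\<real>\<close> contains \<open>\<rat>\<close> automatically.\<close>

definition rat_adjoin :: "real set \<Rightarrow> real set" where
  "rat_adjoin S = generate_field real_ring S"

definition field_degree :: "real set \<Rightarrow> nat" where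
  "field_degree K = ring.dim real_ring \<rat> K"

definition totally_real_number_field :: "real set \<Rightarrow> bool" where
  "totally_real_number_field K \<longleftrightarrow>
     subfield K real_ring \<and> ring.finite_dimension real_ring \<rat> K \<and>
     (\<forall>\<sigma> \<in> ring_hom (real_ring\<lparr>carrier := K\<rparr>) complex_ring. \<sigma> ` K \<subseteq> \<real>)"

text \<open>
  Below, \<open>a\<close> is a matrix whose rows and columns are indexed by the set \<open>P\<close>.  It is applied with
  \<open>P = P(M)\<close> and \<open>a = B\<close>, that is, to the Gram matrix of \<open>P(M)\<close>.
\<close>

definition cyclic_products :: "'i set \<Rightarrow> ('i \<Rightarrow> 'i \<Rightarrow> real) \<Rightarrow> real set" where
  "cyclic_products P a =
     {\<Prod>k<length xs. a (xs ! k) (xs ! (Suc k mod length xs)) | xs. xs \<noteq> [] \<and> set xs \<subseteq> P}"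

definition entry_field :: "'i set \<Rightarrow> ('i \<Rightarrow> 'i \<Rightarrow> real) \<Rightarrow> real set" where
  "entry_field P a = rat_adjoin {a i j | i j. i \<in> P \<and> j \<in> P}"

definition ground_field :: "'i set \<Rightarrow> ('i \<Rightarrow> 'i \<Rightarrow> real) \<Rightarrow> real set" where
  "ground_field P a = rat_adjoin (cyclic_products P a)"

definition neg_semidef :: "'i set \<Rightarrow> ('i \<Rightarrow> 'i \<Rightarrow> real) \<Rightarrow> bool" where
  "neg_semidef P a \<longleftrightarrow> (\<forall>x :: 'i \<Rightarrow> real. (\<Sum>i\<in>P. \<Sum>j\<in>P. x i * a i j * x j) \<le> 0)"

definition V_arithmetic :: "'i set \<Rightarrow> ('i \<Rightarrow> 'i \<Rightarrow> real) \<Rightarrow> bool" where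
  "V_arithmetic P a \<longleftrightarrow>
     finite P \<and>
     totally_real_number_field (ground_field P a) \<and>
     totally_real_number_field (entry_field P a) \<and>
     (\<forall>c\<in>cyclic_products P a. algebraic_int c) \<and>
     (\<forall>\<sigma> \<in> ring_hom (real_ring\<lparr>carrier := entry_field P a\<rparr>) real_ring.
        (\<exists>x\<in>ground_field P a. \<sigma> x \<noteq> x) \<longrightarrow> neg_semidef P (\<lambda>i j. \<sigma> (a i j)))"

definition has_minimality :: "real \<Rightarrow> 'i set \<Rightarrow> ('i \<Rightarrow> 'i \<Rightarrow> real) \<Rightarrow> bool" where
  "has_minimality t P a \<longleftrightarrow> (\<forall>i\<in>P. \<forall>j\<in>P. a i j < t)"

text \<open>
  For a fixed form \<open>B\<close>, the Gram graph of \<open>P\<close> is determined by its vertex set \<open>P\<close>: distinct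
  \<open>x, y \<in> P\<close> carry the weight \<open>B x y\<close>, with weight \<open>0\<close> meaning that they are not joined.
\<close>

definition gram_graph_iso :: "('v \<Rightarrow> 'v \<Rightarrow> real) \<Rightarrow> ('v set \<times> 'v set) set" where
  "gram_graph_iso B =
     {(P, Q). \<exists>f. bij_betw f P Q \<and> (\<forall>x\<in>P. \<forall>y\<in>P. B (f x) (f y) = B x y)}"

section \<open>The pentagon graphs\<close>

text \<open>
  The angle at the point \<open>p\<close> between the geodesics from \<open>p\<close> to \<open>u\<close> and from \<open>p\<close> to \<open>w\<close>.  The
  tangent vectors \<open>s\<close>, \<open>t\<close> are the projections of \<open>u\<close>, \<open>w\<close> to the orthogonal complement of \<open>p\<close>,
  where \<open>-B\<close> is positive definite.
\<close>

definition hyp_angle :: "('v::real_vector \<Rightarrow> 'v \<Rightarrow> real) \<Rightarrow> 'v \<Rightarrow> 'v \<Rightarrow> 'v \<Rightarrow> real" where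
  "hyp_angle B u p w =
     (let s = u - (B u p / B p p) *\<^sub>R p; t = w - (B w p / B p p) *\<^sub>R p
      in arccos (- B s t / sqrt (B s s * B t t)))"

abbreviation nxt :: "nat \<Rightarrow> nat" where
  "nxt i \<equiv> i mod 5 + 1"

text \<open>
  \<open>F\<close> is a compact pentagon whose sides, in cyclic order, are cut out by \<open>d 1, \<dots>, d 5\<close>, and
  whose angle between the sides of \<open>d i\<close> and \<open>d (nxt i)\<close> is \<open>\<alpha> i\<close>.  The vertex common to these
  two sides is the ray of \<open>p i\<close>.  The cone over the pentagon contains \<open>0\<close>, which is not a point
  of hyperbolic space and is therefore removed.
\<close>

definition pentagon ::
    "('v::euclidean_space \<Rightarrow> 'v \<Rightarrow> real) \<Rightarrow> 'v set \<Rightarrow> (nat \<Rightarrow> 'v) \<Rightarrow> (nat \<Rightarrow> real) \<Rightarrow> 'v set \<Rightarrow> bool" where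
  "pentagon B L d \<alpha> F \<longleftrightarrow>
     aff_dim F = 3 \<and>
     bij_betw (\<lambda>i. F \<inter> hplane B (d i)) {1..5} {S. S facet_of F} \<and>
     (\<exists>p. p ` {1..5} \<subseteq> L \<and>
          F = convex_cone hull (p ` {1..5}) - {0} \<and>
          (\<forall>i\<in>{1..5}.
             F \<inter> hplane B (d (nxt i)) = convex_cone hull {p i, p (nxt i)} - {0} \<and>
             hyp_angle B (p i) (p (nxt i)) (p (nxt (nxt i))) = \<alpha> (nxt i)))"

text \<open>
  \<open>P = P(M)\<close> for a fundamental chamber \<open>M\<close> whose face in the intersection of the hyperplanes
  of the vectors in \<open>E\<close> is a pentagon as above.
\<close>

definition chamber_with_pentagon ::
    "('v::euclidean_space \<Rightarrow> 'v \<Rightarrow> real) \<Rightarrow> 'v set \<Rightarrow> (nat \<Rightarrow> 'v) \<Rightarrow> 'v set \<Rightarrow> (nat \<Rightarrow> real) \<Rightarrow> bool" where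
  "chamber_with_pentagon B P d E \<alpha> \<longleftrightarrow>
     P = d ` {1..5} \<union> E \<and>
     (\<exists>L\<in>half_cones B. \<exists>M. fundamental_chamber B L M \<and> P = normals B M \<and>
        pentagon B L d \<alpha> (M \<inter> (\<Inter>e\<in>E. hplane B e)))"

definition pentagon_products :: "('v \<Rightarrow> 'v \<Rightarrow> real) \<Rightarrow> (nat \<Rightarrow> 'v) \<Rightarrow> real \<Rightarrow> bool" where
  "pentagon_products B d c \<longleftrightarrow>
     B (d 1) (d 2) = c \<and> B (d 2) (d 3) = 0 \<and> B (d 3) (d 4) = 0 \<and> B (d 4) (d 5) = 0 \<and>
     B (d 5) (d 1) = 0 \<and>
     B (d 1) (d 3) > 2 \<and> B (d 1) (d 4) > 2 \<and> B (d 2) (d 4) > 2 \<and> B (d 2) (d 5) > 2 \<and>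
     B (d 3) (d 5) > 2"

definition Gamma6_1 :: "('v::euclidean_space \<Rightarrow> 'v \<Rightarrow> real) \<Rightarrow> real \<Rightarrow> 'v set set" where
  "Gamma6_1 B t = {P. V_arithmetic P B \<and> has_minimality t P B \<and>
     (\<exists>d e. \<exists>k::nat. \<exists>m::nat. k \<ge> 3 \<and> m \<ge> 3 \<and>
        chamber_with_pentagon B P d {e} (\<lambda>i. if i = 1 then pi / real k else pi / 2) \<and>
        pentagon_products B d (2 * cos (pi / real k)) \<and>
        B (d 4) e = 2 * cos (pi / real m) \<and> (\<forall>i\<in>{1,2,3,5}. B (d i) e = 0))}"

definition Gamma6_2 :: "('v::euclidean_space \<Rightarrow> 'v \<Rightarrow> real) \<Rightarrow> real \<Rightarrow> 'v set set" where
  "Gamma6_2 B t = {P. V_arithmetic P B \<and> has_minimality t P B \<and>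
     (\<exists>d e. \<exists>m::nat. m \<ge> 3 \<and>
        chamber_with_pentagon B P d {e} (\<lambda>i. pi / 2) \<and>
        pentagon_products B d 0 \<and>
        B (d 1) e = 2 * cos (pi / real m) \<and> (\<forall>i\<in>{2,3,4,5}. B (d i) e = 0))}"

definition Gamma6_3 :: "('v::euclidean_space \<Rightarrow> 'v \<Rightarrow> real) \<Rightarrow> real \<Rightarrow> 'v set set" where
  "Gamma6_3 B t = {P. V_arithmetic P B \<and> has_minimality t P B \<and>
     (\<exists>d e. \<exists>m1::nat. \<exists>m3::nat. m1 \<ge> 3 \<and> m3 \<ge> 3 \<and>
        chamber_with_pentagon B P d {e} (\<lambda>i. pi / 2) \<and>
        pentagon_products B d 0 \<and>
        B (d 1) e = 2 * cos (pi / real m1) \<and> B (d 3) e = 2 * cos (pi / real m3) \<and>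
        (\<forall>i\<in>{2,4,5}. B (d i) e = 0))}"

definition Gamma7_1 :: "('v::euclidean_space \<Rightarrow> 'v \<Rightarrow> real) \<Rightarrow> real \<Rightarrow> 'v set set" where
  "Gamma7_1 B t = {P. V_arithmetic P B \<and> has_minimality t P B \<and>
     (\<exists>d e1 e2. \<exists>m1::nat. \<exists>m2::nat. m1 \<ge> 3 \<and> m2 \<ge> 3 \<and>
        chamber_with_pentagon B P d {e1, e2} (\<lambda>i. pi / 2) \<and>
        pentagon_products B d 0 \<and> B e1 e2 = 0 \<and>
        B (d 1) e1 = 2 * cos (pi / real m1) \<and> (\<forall>i\<in>{2,3,4,5}. B (d i) e1 = 0) \<and>
        B (d 2) e2 = 2 * cos (pi / real m2) \<and> (\<forall>i\<in>{1,3,4,5}. B (d i) e2 = 0))}"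

definition Gamma7_2 :: "('v::euclidean_space \<Rightarrow> 'v \<Rightarrow> real) \<Rightarrow> real \<Rightarrow> 'v set set" where
  "Gamma7_2 B t = {P. V_arithmetic P B \<and> has_minimality t P B \<and>
     (\<exists>d e1 e2. \<exists>m1::nat. \<exists>m2::nat. \<exists>m3::nat. m1 \<ge> 3 \<and> m2 \<ge> 3 \<and> m3 \<ge> 3 \<and>
        chamber_with_pentagon B P d {e1, e2} (\<lambda>i. pi / 2) \<and>
        pentagon_products B d 0 \<and> B e1 e2 = 0 \<and>
        B (d 1) e1 = 2 * cos (pi / real m1) \<and> B (d 3) e1 = 2 * cos (pi / real m3) \<and>
        (\<forall>i\<in>{2,4,5}. B (d i) e1 = 0) \<and>
        B (d 2) e2 = 2 * cos (pi / real m2) \<and> (\<forall>i\<in>{1,3,4,5}. B (d i) e2 = 0))}"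

definition ground_fields :: "('v \<Rightarrow> 'v \<Rightarrow> real) \<Rightarrow> 'v set set \<Rightarrow> real set set" where
  "ground_fields B S = (\<lambda>P. ground_field P B) ` S"

end

theory Submission
  imports Defs "Jordan_Normal_Form.Char_Poly"
begin

hide_const (open) Polynomials.degree Polynomials.lead_coeff up_ring.coeff up_ring.monom
  Coset.order Module.smult Ring_Hom.ring_hom

text \<open>
  In each of the five families the Gram graph contains a star with two edges: a vertex \<open>u\<close> joined to
  \<open>v\<close> by a weight \<open>a\<^sub>u\<^sub>v \<in> (2, 14)\<close> and to \<open>w\<close> by \<open>2 cos (\<pi>/m)\<close>, with \<open>v\<close> and \<open>w\<close> not joined.  Put
  \<open>\<alpha> = a\<^sub>u\<^sub>v\<^sup>2 \<in> (4, 196)\<close> and \<open>s = 4 - (2 cos (\<pi>/m))\<^sup>2 = 4 sin\<^sup>2 (\<pi>/m)\<close>.  Both are algebraic integers of the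
  ground field \<open>K\<close>.  An embedding \<open>\<sigma>\<close> that is not the identity on \<open>K\<close> makes the Gram matrix negative
  semidefinite, and the star then gives \<open>0 \<le> \<sigma> \<alpha> \<le> \<sigma> s \<le> 4\<close> (\<open>neg_semidef_star\<close>).  In particular
  \<open>\<sigma>\<close> moves \<open>\<alpha>\<close>, so \<open>K = \<rat>(\<alpha>)\<close> (\<open>K_generated\<close>), and the embeddings of \<open>K\<close> correspond to the
  \<open>N = [K : \<rat>]\<close> conjugates of \<open>\<alpha>\<close>.

  The norm of a nonzero algebraic integer \<open>\<beta>\<close> of \<open>K\<close> is a nonzero integer (\<open>norm_ge_1\<close>).  If
  \<open>\<bar>\<sigma> \<beta>\<bar> \<le> c < 1\<close> for all \<open>\<sigma> \<noteq> id\<close>, then \<open>1 \<le> \<bar>\<beta>\<bar> c\<^bsup>N - 1\<^esup>\<close> bounds \<open>N\<close>.  Suitable \<open>\<beta>\<close> are polynomials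
  in \<open>s\<close> and \<open>z = \<alpha> (s - \<alpha>)\<close>, where \<open>0 \<le> \<sigma> z \<le> (\<sigma> s)\<^sup>2/4\<close>: for \<open>m > 3\<close> the element
  \<open>z (z - (s - 1)) (4 - s) (3 - s)\<close>, and for \<open>m = 3\<close>, where \<open>s = 3\<close>, the element
  \<open>z\<^sup>2 (z - 1)\<^sup>2 (2 - z)\<^sup>3 (z\<^sup>2 - 3 z + 1)\<close>.  The inequalities \<open>auxiliary_bound\<close> and
  \<open>auxiliary_bound_3\<close> give \<open>N \<le> 42\<close> for all five families (\<open>degree_bound\<close>).

  Finiteness follows.  The square of an off-diagonal entry is an algebraic integer of \<open>K\<close> with all
  conjugates at most \<open>196\<close> in absolute value, hence one of finitely many numbers
  (\<open>in_bounded_integral_roots\<close>).  The off-diagonal entries are nonnegative, and there are at most seven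
  vertices, so there are finitely many Gram matrices up to isomorphism, and they determine the
  ground fields.

  Three algebraic tools are proved on the way: sums and products of algebraic integers are algebraic
  integers; an embedding of a subfield into \<open>\<complex>\<close> extends to a number field, sending an element
  to any prescribed conjugate (\<open>embedding_extend_root\<close>); and the product of the values of a rational
  polynomial at the roots of another one is rational (\<open>prod_over_roots_rational\<close>).
\<close>

section \<open>Sums and products of algebraic integers\<close>

text \<open>The \<open>\<int>\<close>-module generated by the family \<open>v\<close> over the finite index set \<open>I\<close>.\<close>

definition int_span :: "'i set \<Rightarrow> ('i \<Rightarrow> 'a::comm_ring_1) \<Rightarrow> 'a set" where
  "int_span I v = {x. \<exists>c :: 'i \<Rightarrow> int. x = (\<Sum>i\<in>I. of_int (c i) * v i)}"

text \<open>
  If multiplication by \<open>x\<close> maps a finitely generated \<open>\<int>\<close>-module into itself, then \<open>x\<close> is an eigenvalue of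
  an integer matrix, hence a root of its monic integral characteristic polynomial.
\<close>

lemma algebraic_int_if_module_closed_nat:
  fixes x :: "'a::field_char_0" and v :: "nat \<Rightarrow> 'a"
  assumes mult: "\<And>i. i < n \<Longrightarrow> x * v i \<in> int_span {..<n} v"
    and nz: "k < n" "v k \<noteq> 0"
  shows "algebraic_int x"
proof -
  have "\<forall>i::nat. \<exists>c :: nat \<Rightarrow> int. i < n \<longrightarrow> x * v i = (\<Sum>j<n. of_int (c j) * v j)"
    using mult unfolding int_span_def by blast
  then obtain c :: "nat \<Rightarrow> nat \<Rightarrow> int" where c: "\<And>i. i < n \<Longrightarrow> x * v i = (\<Sum>j<n. of_int (c i j) * v j)"
    by metis
  define A where "A = Matrix.mat n n (\<lambda>(i, j). c i j)"
  define A' where "A' = Matrix.mat n n (\<lambda>(i, j). of_int (c i j) :: 'a)"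
  have A: "A \<in> carrier_mat n n" and A': "A' \<in> carrier_mat n n" by (auto simp: A_def A'_def)
  have hom: "A' = map_mat of_int A" by (auto simp: A_def A'_def)
  have "eigenvector A' (Matrix.vec n v) x"
    unfolding eigenvector_def
  proof (intro conjI)
    show "Matrix.vec n v \<in> carrier_vec (dim_row A')" by (auto simp: A'_def)
    show "Matrix.vec n v \<noteq> 0\<^sub>v (dim_row A')" using nz by (auto simp: A'_def vec_eq_iff)
    show "A' *\<^sub>v Matrix.vec n v = x \<cdot>\<^sub>v Matrix.vec n v"
      by (rule eq_vecI) (auto simp: A'_def scalar_prod_def c atLeast0LessThan)
  qed
  hence "poly (char_poly A') x = 0"
    using eigenvalue_root_char_poly[OF A'] unfolding eigenvalue_def by blast
  moreover have "char_poly A' = map_poly of_int (char_poly A)"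
    unfolding hom by (rule of_int_hom.char_poly_hom[OF A])
  ultimately show ?thesis
    unfolding algebraic_int_altdef_ipoly using degree_monic_char_poly[OF A] by auto
qed

lemma algebraic_int_if_module_closed:
  fixes x :: "'a::field_char_0"
  assumes I: "finite I" and mult: "\<And>i. i \<in> I \<Longrightarrow> x * v i \<in> int_span I v"
    and nz: "k \<in> I" "v k \<noteq> 0"
  shows "algebraic_int x"
proof -
  obtain f where f: "bij_betw f {..<card I} I"
    using bij_betw_from_nat_into_finite[OF I] ex_bij_betw_nat_finite[OF I] atLeast0LessThan by metis
  have re: "(\<Sum>i\<in>I. of_int (c i) * v i) = (\<Sum>j<card I. of_int (c (f j)) * v (f j))" for c :: "_ \<Rightarrow> int"
    by (rule sum.reindex_bij_betw[OF f, symmetric])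
  have "x * v (f i) \<in> int_span {..<card I} (v \<circ> f)" if "i < card I" for i
  proof -
    have "f i \<in> I" using f that by (auto simp: bij_betw_def)
    from mult[OF this] obtain c :: "_ \<Rightarrow> int" where "x * v (f i) = (\<Sum>i\<in>I. of_int (c i) * v i)"
      unfolding int_span_def by blast
    thus ?thesis unfolding int_span_def re by (auto intro!: exI[of _ "c \<circ> f"])
  qed
  moreover have "k \<in> f ` {..<card I}" using f nz(1) by (simp add: bij_betw_def)
  then obtain k' where "k' < card I" "f k' = k" by blast
  ultimately show ?thesis using nz(2)
    by (intro algebraic_int_if_module_closed_nat[of "card I" x "v \<circ> f" k']) auto
qed

lemma int_span_add: "x \<in> int_span I v \<Longrightarrow> y \<in> int_span I v \<Longrightarrow> x + y \<in> int_span I v"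
proof -
  assume "x \<in> int_span I v" "y \<in> int_span I v"
  then obtain c d :: "_ \<Rightarrow> int" where "x = (\<Sum>i\<in>I. of_int (c i) * v i)" "y = (\<Sum>i\<in>I. of_int (d i) * v i)"
    unfolding int_span_def by blast
  hence "x + y = (\<Sum>i\<in>I. of_int (c i + d i) * v i)"
    by (simp add: sum.distrib algebra_simps)
  thus ?thesis unfolding int_span_def by (blast intro: exI[of _ "\<lambda>i. c i + d i"])
qed

lemma int_span_scale: "x \<in> int_span I v \<Longrightarrow> of_int m * x \<in> int_span I v"
proof -
  assume "x \<in> int_span I v"
  then obtain c :: "_ \<Rightarrow> int" where "x = (\<Sum>i\<in>I. of_int (c i) * v i)"
    unfolding int_span_def by blast
  hence "of_int m * x = (\<Sum>i\<in>I. of_int (m * c i) * v i)"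
    by (simp add: sum_distrib_left algebra_simps)
  thus ?thesis unfolding int_span_def by (blast intro: exI[of _ "\<lambda>i. m * c i"])
qed

lemma int_span_0: "0 \<in> int_span I v"
  unfolding int_span_def by (auto intro!: exI[of _ "\<lambda>_. 0"])

lemma int_span_sum: "(\<And>k. k \<in> A \<Longrightarrow> f k \<in> int_span I v) \<Longrightarrow> sum f A \<in> int_span I v"
  by (induction A rule: infinite_finite_induct) (auto intro: int_span_add int_span_0)

lemma int_span_base: "finite I \<Longrightarrow> i \<in> I \<Longrightarrow> v i \<in> int_span I v"
  unfolding int_span_def
  by (auto intro!: exI[of _ "\<lambda>j. if j = i then 1 else 0"] simp: if_distrib[of of_int] if_distrib[of "\<lambda>a. a * _"] sum.delta cong: if_cong)

lemma integral_power_reduce: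
  fixes x :: "'a::field_char_0"
  assumes "algebraic_int x"
  obtains n c where "n > 0" "x ^ n = (\<Sum>i<n. of_int (c i) * x ^ i)"
proof -
  from assms obtain p :: "int poly" where p: "poly (map_poly of_int p) x = 0" "lead_coeff p = 1"
    unfolding algebraic_int_altdef_ipoly by blast
  define n where "n = degree p"
  have "n > 0"
  proof (rule ccontr)
    assume "\<not> n > 0"
    hence "p = 1" using p(2) by (auto simp: n_def one_pCons elim!: degree_eq_zeroE)
    thus False using p(1) by simp
  qed
  have "0 = (\<Sum>i\<le>n. of_int (coeff p i) * x ^ i)"
    using p(1) by (simp add: poly_altdef degree_map_poly coeff_map_poly n_def)
  also have "\<dots> = (\<Sum>i<n. of_int (coeff p i) * x ^ i) + x ^ n"
    using p(2) by (simp add: n_def flip: lessThan_Suc_atMost)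
  finally have "x ^ n = (\<Sum>i<n. of_int (- coeff p i) * x ^ i)"
    by (simp add: sum_negf add_eq_0_iff)
  with \<open>n > 0\<close> show thesis by (rule that)
qed

lemma
  fixes x y :: "'a::field_char_0"
  assumes x: "algebraic_int x" and y: "algebraic_int y"
  shows algebraic_int_plus: "algebraic_int (x + y)"
    and algebraic_int_times: "algebraic_int (x * y)"
proof -
  obtain m c where m: "m > 0" "x ^ m = (\<Sum>i<m. of_int (c i) * x ^ i)"
    by (rule integral_power_reduce[OF x])
  obtain n d where n: "n > 0" "y ^ n = (\<Sum>i<n. of_int (d i) * y ^ i)"
    by (rule integral_power_reduce[OF y])
  \<comment> \<open>The monomials below the degrees of the two integral equations span a module closed under
    multiplication by \<open>x\<close> and by \<open>y\<close>.\<close>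
  define I where "I = {..<m} \<times> {..<n}"
  define v where "v = (\<lambda>(i, j). x ^ i * y ^ j)"
  let ?M = "int_span I v"
  have I: "finite I" by (simp add: I_def)
  have base: "x ^ i * y ^ j \<in> ?M" if "i < m" "j < n" for i j
    using int_span_base[OF I, of "(i, j)" v] that by (simp add: I_def v_def)
  have xbase: "x * (x ^ i * y ^ j) \<in> ?M" if "i < m" "j < n" for i j
  proof (cases "Suc i = m")
    case True
    have "x * (x ^ i * y ^ j) = x ^ m * y ^ j" by (simp flip: True)
    also have "\<dots> = (\<Sum>i<m. of_int (c i) * (x ^ i * y ^ j))"
      by (simp add: m(2) sum_distrib_right mult.assoc)
    also have "\<dots> \<in> ?M" by (intro int_span_sum int_span_scale base) (use that in auto)
    finally show ?thesis .
  next
    case False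
    thus ?thesis using base[of "Suc i" j] that by (simp add: mult.assoc)
  qed
  have ybase: "y * (x ^ i * y ^ j) \<in> ?M" if "i < m" "j < n" for i j
  proof (cases "Suc j = n")
    case True
    have "y * (x ^ i * y ^ j) = y ^ n * x ^ i" by (simp flip: True)
    also have "\<dots> = (\<Sum>j<n. of_int (d j) * (x ^ i * y ^ j))"
      by (simp add: n(2) sum_distrib_left mult_ac)
    also have "\<dots> \<in> ?M" by (intro int_span_sum int_span_scale base) (use that in auto)
    finally show ?thesis .
  next
    case False
    thus ?thesis using base[of i "Suc j"] that by (simp add: mult_ac)
  qed
  have closed: "z * w \<in> ?M" if "w \<in> ?M" and z: "\<And>i j. i < m \<Longrightarrow> j < n \<Longrightarrow> z * (x ^ i * y ^ j) \<in> ?M" for z w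
  proof -
    from that(1) obtain e :: "_ \<Rightarrow> int" where "w = (\<Sum>k\<in>I. of_int (e k) * v k)"
      unfolding int_span_def by blast
    hence "z * w = (\<Sum>k\<in>I. of_int (e k) * (z * v k))" by (simp add: sum_distrib_left mult_ac)
    also have "\<dots> \<in> ?M"
      by (intro int_span_sum int_span_scale) (use z in \<open>auto simp: I_def v_def\<close>)
    finally show ?thesis .
  qed
  have nz: "(0, 0) \<in> I" "v (0, 0) \<noteq> 0" using m n by (auto simp: I_def v_def)
  show "algebraic_int (x + y)"
  proof (rule algebraic_int_if_module_closed[where v = v and I = I, OF I _ nz])
    show "(x + y) * v k \<in> ?M" if "k \<in> I" for k
      using that int_span_add[OF xbase ybase] by (auto simp: I_def v_def distrib_right)
  qed
  show "algebraic_int (x * y)"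
  proof (rule algebraic_int_if_module_closed[where v = v and I = I, OF I _ nz])
    show "(x * y) * v k \<in> ?M" if "k \<in> I" for k
      using that closed[OF ybase xbase] by (auto simp: I_def v_def mult.assoc)
  qed
qed

section \<open>Extending embeddings of real fields\<close>

text \<open>A subset of \<open>\<real>\<close> that is a field.  Closure under \<open>inverse\<close> is unconditional as \<open>inverse 0 = 0\<close>.\<close>

definition real_subfield :: "real set \<Rightarrow> bool" where
  "real_subfield E \<longleftrightarrow> 1 \<in> E \<and> (\<forall>x\<in>E. \<forall>y\<in>E. x + y \<in> E \<and> x * y \<in> E) \<and>
     (\<forall>x\<in>E. - x \<in> E \<and> inverse x \<in> E)"

text \<open>An embedding of the real field \<open>E\<close>; its values outside \<open>E\<close> are irrelevant.\<close>

definition embedding :: "real set \<Rightarrow> (real \<Rightarrow> 'b::field_char_0) \<Rightarrow> bool" where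
  "embedding E \<sigma> \<longleftrightarrow> \<sigma> 1 = 1 \<and> (\<forall>x\<in>E. \<forall>y\<in>E. \<sigma> (x + y) = \<sigma> x + \<sigma> y \<and> \<sigma> (x * y) = \<sigma> x * \<sigma> y)"

text \<open>The polynomials with coefficients in \<open>E\<close>.\<close>

definition coeffs_in :: "'a::zero set \<Rightarrow> 'a poly \<Rightarrow> bool" where
  "coeffs_in E p \<longleftrightarrow> (\<forall>i. coeff p i \<in> E)"

lemma real_subfieldD:
  assumes "real_subfield E"
  shows "1 \<in> E" "0 \<in> E"
    and "\<And>x y. x \<in> E \<Longrightarrow> y \<in> E \<Longrightarrow> x + y \<in> E"
    and "\<And>x y. x \<in> E \<Longrightarrow> y \<in> E \<Longrightarrow> x * y \<in> E"
    and "\<And>x y. x \<in> E \<Longrightarrow> y \<in> E \<Longrightarrow> x - y \<in> E"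
    and "\<And>x y. x \<in> E \<Longrightarrow> y \<in> E \<Longrightarrow> x / y \<in> E"
    and "\<And>x. x \<in> E \<Longrightarrow> - x \<in> E"
    and "\<And>x. x \<in> E \<Longrightarrow> inverse x \<in> E"
    and "\<And>x n. x \<in> E \<Longrightarrow> x ^ n \<in> E"
    and "\<And>A f. (\<And>i. i \<in> A \<Longrightarrow> f i \<in> E) \<Longrightarrow> sum f A \<in> E"
proof -
  show 1: "1 \<in> E" and add: "\<And>x y. x \<in> E \<Longrightarrow> y \<in> E \<Longrightarrow> x + y \<in> E"
    and mult: "\<And>x y. x \<in> E \<Longrightarrow> y \<in> E \<Longrightarrow> x * y \<in> E"
    and m: "\<And>x. x \<in> E \<Longrightarrow> - x \<in> E" and inv: "\<And>x. x \<in> E \<Longrightarrow> inverse x \<in> E"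
    using assms unfolding real_subfield_def by auto
  show 0: "0 \<in> E" using add[OF 1 m[OF 1]] by simp
  show "\<And>x y. x \<in> E \<Longrightarrow> y \<in> E \<Longrightarrow> x - y \<in> E"
    using add m by (metis diff_conv_add_uminus)
  show "\<And>x y. x \<in> E \<Longrightarrow> y \<in> E \<Longrightarrow> x / y \<in> E"
    using mult inv by (metis divide_inverse)
  show "x ^ n \<in> E" if "x \<in> E" for x n
    using that by (induction n) (auto intro: 1 mult)
  show "sum f A \<in> E" if "\<And>i. i \<in> A \<Longrightarrow> f i \<in> E" for A f
    using that by (induction A rule: infinite_finite_induct) (auto intro: 0 add)
qed

lemma real_subfield_Rats:
  assumes "real_subfield E" shows "\<rat> \<subseteq> E"
proof
  note E = real_subfieldD[OF assms]
  have n: "real n \<in> E" for n by (induction n) (auto intro: E)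
  have i: "of_int k \<in> E" for k :: int
    using n[of "nat k"] E(7)[OF n[of "nat (- k)"]] by (cases "k \<ge> 0") auto
  fix x :: real assume "x \<in> \<rat>"
  then obtain a b where "x = of_int a / of_int b" by (auto elim: Rats_cases')
  thus "x \<in> E" using E(6)[OF i i] by simp
qed

lemma real_subfield_rat: "real_subfield (\<rat> :: real set)"
  unfolding real_subfield_def by auto

lemma embeddingD:
  assumes E: "real_subfield E" and \<sigma>: "embedding E \<sigma>"
  shows "\<sigma> 1 = 1" "\<sigma> 0 = 0"
    and "\<And>x y. x \<in> E \<Longrightarrow> y \<in> E \<Longrightarrow> \<sigma> (x + y) = \<sigma> x + \<sigma> y"
    and "\<And>x y. x \<in> E \<Longrightarrow> y \<in> E \<Longrightarrow> \<sigma> (x * y) = \<sigma> x * \<sigma> y"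
    and "\<And>x. x \<in> E \<Longrightarrow> \<sigma> (- x) = - \<sigma> x"
    and "\<And>x y. x \<in> E \<Longrightarrow> y \<in> E \<Longrightarrow> \<sigma> (x - y) = \<sigma> x - \<sigma> y"
    and "\<And>x n. x \<in> E \<Longrightarrow> \<sigma> (x ^ n) = \<sigma> x ^ n"
    and "\<And>A f. (\<And>i. i \<in> A \<Longrightarrow> f i \<in> E) \<Longrightarrow> \<sigma> (sum f A) = (\<Sum>i\<in>A. \<sigma> (f i))"
    and "\<And>x. x \<in> E \<Longrightarrow> \<sigma> x = 0 \<longleftrightarrow> x = 0"
proof -
  note E = real_subfieldD[OF E]
  show 1: "\<sigma> 1 = 1" and add: "\<And>x y. x \<in> E \<Longrightarrow> y \<in> E \<Longrightarrow> \<sigma> (x + y) = \<sigma> x + \<sigma> y"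
    and mult: "\<And>x y. x \<in> E \<Longrightarrow> y \<in> E \<Longrightarrow> \<sigma> (x * y) = \<sigma> x * \<sigma> y"
    using \<sigma> unfolding embedding_def by auto
  show 0: "\<sigma> 0 = 0" using add[OF E(2) E(2)] by simp
  show m: "\<sigma> (- x) = - \<sigma> x" if "x \<in> E" for x
    using add[OF that E(7)[OF that]] 0 by (simp add: add_eq_0_iff)
  show "\<sigma> (x - y) = \<sigma> x - \<sigma> y" if "x \<in> E" "y \<in> E" for x y
    using add[OF that(1) E(7)[OF that(2)]] m[OF that(2)] by simp
  show "\<sigma> (x ^ n) = \<sigma> x ^ n" if "x \<in> E" for x n
    by (induction n) (auto simp: 1 mult that E(9))
  show "\<sigma> (sum f A) = (\<Sum>i\<in>A. \<sigma> (f i))" if "\<And>i. i \<in> A \<Longrightarrow> f i \<in> E" for A f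
    using that by (induction A rule: infinite_finite_induct) (auto simp: 0 add E(10))
  show "\<sigma> x = 0 \<longleftrightarrow> x = 0" if "x \<in> E" for x
  proof
    assume "\<sigma> x = 0"
    show "x = 0"
    proof (rule ccontr)
      assume "x \<noteq> 0"
      hence "\<sigma> (x * inverse x) = 1" using 1 by simp
      thus False using mult[OF that E(8)[OF that]] \<open>\<sigma> x = 0\<close> by simp
    qed
  qed (simp add: 0)
qed

lemma embedding_of_rat:
  assumes E: "real_subfield E" and \<sigma>: "embedding E \<sigma>"
  shows "\<sigma> (of_rat q) = of_rat q"
proof -
  note S = embeddingD[OF E \<sigma>] and D = real_subfieldD[OF E]
  have nE: "real n \<in> E" for n by (induction n) (auto intro: D)
  have n: "\<sigma> (real n) = of_nat n" for n
    by (induction n) (auto simp: S(1-3) nE D(1) add.commute)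
  have iE: "of_int k \<in> E" for k :: int
    using nE[of "nat k"] D(7)[OF nE[of "nat (- k)"]] by (cases "k \<ge> 0") auto
  have i: "\<sigma> (of_int k) = of_int k" for k :: int
    using n[of "nat k"] S(5)[OF nE[of "nat (- k)"]] n[of "nat (- k)"] by (cases "k \<ge> 0") auto
  obtain a b where ab: "q = of_int a / of_int b" "b > 0"
    by (metis quotient_of_denom_pos' quotient_of_div surjective_pairing Fract_of_int_quotient)
  have qE: "of_rat q \<in> E" using real_subfield_Rats[OF E] by auto
  have "of_rat q * of_int b = (of_int a :: real)" using ab by (simp add: of_rat_divide)
  hence "\<sigma> (of_rat q) * of_int b = of_int a" using S(4)[OF qE iE[of b]] i by metis
  hence "\<sigma> (of_rat q) = of_int a / of_int b" using ab(2) by (simp add: field_simps)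
  thus ?thesis using ab(1) by (simp add: of_rat_divide)
qed

lemma coeffs_in_simps:
  assumes "real_subfield E" "coeffs_in E p" "coeffs_in E q"
  shows "coeffs_in E (p + q)" "coeffs_in E (p - q)" "coeffs_in E (p * q)" "coeffs_in E (- p)"
proof -
  note D = real_subfieldD[OF assms(1)] and pq = assms(2,3)[unfolded coeffs_in_def]
  show "coeffs_in E (p + q)" "coeffs_in E (p - q)" "coeffs_in E (- p)"
    using D(3,5,7) pq unfolding coeffs_in_def by auto
  show "coeffs_in E (p * q)"
    unfolding coeffs_in_def coeff_mult using D(4) pq by (intro allI D(10)) auto
qed

lemma coeffs_in_monom: "real_subfield E \<Longrightarrow> a \<in> E \<Longrightarrow> coeffs_in E (Polynomial.monom a n)"
  unfolding coeffs_in_def by (auto simp: coeff_monom dest: real_subfieldD(2))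

lemma coeffs_in_pCons: "real_subfield E \<Longrightarrow> a \<in> E \<Longrightarrow> coeffs_in E p \<Longrightarrow> coeffs_in E (pCons a p)"
  unfolding coeffs_in_def by (auto simp: coeff_pCons split: nat.split)

lemma coeffs_in_0: "real_subfield E \<Longrightarrow> coeffs_in E 0"
  unfolding coeffs_in_def by (auto dest: real_subfieldD(2))

lemma poly_in_subfield:
  assumes "real_subfield E" "coeffs_in E p" "x \<in> E" shows "poly p x \<in> E"
proof -
  note D = real_subfieldD[OF assms(1)]
  show ?thesis
    unfolding poly_altdef using assms(2,3) unfolding coeffs_in_def by (intro D(10) D(4) D(9)) auto
qed

text \<open>Euclidean division does not leave the polynomials over \<open>E\<close>.\<close>

lemma subfield_poly_division:
  assumes E: "real_subfield E" and p: "coeffs_in E p" and q: "coeffs_in E q" "q \<noteq> 0"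
  obtains t r where "coeffs_in E t" "coeffs_in E r" "p = q * t + r" "r = 0 \<or> degree r < degree q"
proof -
  note D = real_subfieldD[OF E]
  have "\<exists>t r. coeffs_in E t \<and> coeffs_in E r \<and> p = q * t + r \<and> (r = 0 \<or> degree r < degree q)"
    using p
  proof (induction "degree p" arbitrary: p rule: less_induct)
    case less
    show ?case
    proof (cases "p = 0 \<or> degree p < degree q")
      case True
      thus ?thesis by (intro exI[of _ 0] exI[of _ p]) (use less.prems coeffs_in_0[OF E] in auto)
    next
      case False
      \<comment> \<open>Cancel the leading term of \<open>p\<close>.\<close>
      define m where "m = Polynomial.monom (lead_coeff p / lead_coeff q) (degree p - degree q)"
      have m: "coeffs_in E m" unfolding m_def
        by (rule coeffs_in_monom[OF E]) (use D(6) less.prems q in \<open>auto simp: coeffs_in_def\<close>)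
      define p' where "p' = p - q * m"
      have p': "coeffs_in E p'" unfolding p'_def by (intro coeffs_in_simps[OF E] less.prems q m)
      have mnz: "m \<noteq> 0" "degree m = degree p - degree q" using False q unfolding m_def
        by (auto simp: degree_monom_eq)
      have dm: "degree (q * m) = degree p"
        using degree_mult_eq[OF q(2) mnz(1)] mnz(2) False by simp
      have lm: "coeff (q * m) (degree p) = lead_coeff p"
        using lead_coeff_mult[of q m] dm mnz(2) q(2) unfolding m_def by simp
      show ?thesis
      proof (cases "p' = 0")
        case True
        thus ?thesis unfolding p'_def
          by (intro exI[of _ m] exI[of _ 0]) (use m coeffs_in_0[OF E] in auto)
      next
        case nz: False
        have le: "degree p' \<le> degree p" unfolding p'_def by (rule degree_diff_le) (use dm in auto)
        have "coeff p' (degree p) = 0" unfolding p'_def using lm by simp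
        hence "degree p' \<noteq> degree p" using nz by (metis leading_coeff_0_iff)
        hence "degree p' < degree p" using le by simp
        from less.hyps[OF this p'] obtain t r where tr: "coeffs_in E t" "coeffs_in E r"
          "p' = q * t + r" "r = 0 \<or> degree r < degree q" by blast
        have "p = q * (m + t) + r" using tr(3) unfolding p'_def by (simp add: algebra_simps)
        thus ?thesis using tr coeffs_in_simps(1)[OF E m tr(1)] by blast
      qed
    qed
  qed
  thus thesis using that by blast
qed

text \<open>\<open>p\<close> is a minimal polynomial of \<open>x\<close> over \<open>E\<close> (not necessarily monic).\<close>

definition min_poly :: "real set \<Rightarrow> real \<Rightarrow> real poly \<Rightarrow> bool" where
  "min_poly E x p \<longleftrightarrow> coeffs_in E p \<and> p \<noteq> 0 \<and> poly p x = 0 \<and>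
     (\<forall>q. coeffs_in E q \<longrightarrow> q \<noteq> 0 \<longrightarrow> poly q x = 0 \<longrightarrow> degree p \<le> degree q)"

lemma min_poly_exists:
  assumes "coeffs_in E q" "q \<noteq> 0" "poly q x = 0"
  obtains p where "min_poly E x p"
proof -
  let ?P = "\<lambda>q. coeffs_in E q \<and> q \<noteq> 0 \<and> poly q x = 0"
  have "?P (arg_min degree ?P) \<and> (\<forall>q. ?P q \<longrightarrow> degree (arg_min degree ?P) \<le> degree q)"
    by (rule arg_min_nat_lemma[of ?P q]) (use assms in auto)
  thus thesis using that unfolding min_poly_def by blast
qed

lemma min_poly_dvd:
  assumes E: "real_subfield E" and p: "min_poly E x p" and q: "coeffs_in E q" "poly q x = 0"
  obtains t where "coeffs_in E t" "q = p * t"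
proof -
  obtain t r where tr: "coeffs_in E t" "coeffs_in E r" "q = p * t + r" "r = 0 \<or> degree r < degree p"
    using subfield_poly_division[OF E q(1), of p] p unfolding min_poly_def by metis
  have "poly r x = 0" using tr(3) q(2) p unfolding min_poly_def by simp
  hence "r = 0" using p tr(2,4) unfolding min_poly_def by force
  thus thesis using that tr by simp
qed

lemma min_poly_degree_pos: "min_poly E x p \<Longrightarrow> degree p > 0"
  unfolding min_poly_def by (auto intro!: Nat.gr0I elim!: degree_eq_zeroE)

text \<open>Values at \<open>x\<close> of polynomials over \<open>E\<close>; the field \<open>E(x)\<close> when \<open>x\<close> is algebraic over \<open>E\<close>.\<close>

definition adjoin :: "real set \<Rightarrow> real \<Rightarrow> real set" where
  "adjoin E x = {poly q x | q. coeffs_in E q}"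

lemma adjoin_minimal: "real_subfield L \<Longrightarrow> E \<subseteq> L \<Longrightarrow> x \<in> L \<Longrightarrow> adjoin E x \<subseteq> L"
  unfolding adjoin_def by (auto intro!: poly_in_subfield simp: coeffs_in_def subset_iff)

lemma adjoin_base: "real_subfield E \<Longrightarrow> E \<subseteq> adjoin E x"
proof
  fix e assume "real_subfield E" "e \<in> E"
  hence "coeffs_in E [:e:]" by (intro coeffs_in_pCons coeffs_in_0)
  thus "e \<in> adjoin E x" unfolding adjoin_def by (auto intro!: exI[of _ "[:e:]"])
qed

lemma adjoin_elem: "real_subfield E \<Longrightarrow> x \<in> adjoin E x"
proof -
  assume E: "real_subfield E"
  hence "coeffs_in E [:0, 1:]" by (intro coeffs_in_pCons coeffs_in_0) (auto dest: real_subfieldD)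
  thus ?thesis unfolding adjoin_def by (auto intro!: exI[of _ "[:0, 1:]"])
qed

lemma adjoin_subfield:
  assumes E: "real_subfield E" and p: "min_poly E x p"
  shows "real_subfield (adjoin E x)"
proof -
  note D = real_subfieldD[OF E]
  \<comment> \<open>Inverses come from dividing \<open>p\<close> by \<open>q\<close>: at \<open>x\<close> the remainder is a multiple of \<open>q\<close>, and it is
    nonzero by minimality of \<open>p\<close>.\<close>
  have inv: "\<exists>u. coeffs_in E u \<and> poly u x * poly q x = 1"
    if "coeffs_in E q" "q \<noteq> 0" "degree q < degree p" for q
    using that
  proof (induction "degree q" arbitrary: q rule: less_induct)
    case less
    show ?case
    proof (cases "degree q = 0")
      case True
      then obtain c where c: "q = [:c:]" by (auto elim: degree_eq_zeroE)
      have "c \<in> E" using less.prems(1) unfolding c coeffs_in_def by (metis coeff_pCons_0)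
      hence "coeffs_in E [:inverse c:]" using D(8) E by (intro coeffs_in_pCons coeffs_in_0) auto
      thus ?thesis using less.prems(2) c by (intro exI[of _ "[:inverse c:]"]) auto
    next
      case False
      have pE: "coeffs_in E p" "p \<noteq> 0" "poly p x = 0" using p unfolding min_poly_def by auto
      obtain t r where tr: "coeffs_in E t" "coeffs_in E r" "p = q * t + r" "r = 0 \<or> degree r < degree q"
        using subfield_poly_division[OF E pE(1) less.prems(1,2)] by blast
      have r0: "r \<noteq> 0"
      proof
        assume "r = 0"
        hence pq: "p = q * t" using tr by simp
        hence "t \<noteq> 0" using pE by auto
        hence "degree t < degree p" using pq degree_mult_eq[of q t] less.prems(2) False by simp
        hence "poly t x \<noteq> 0" using p tr(1) \<open>t \<noteq> 0\<close> unfolding min_poly_def by force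
        moreover have "poly q x \<noteq> 0" using p less.prems unfolding min_poly_def by force
        ultimately show False using pq pE(3) by simp
      qed
      hence dr: "degree r < degree q" using tr(4) by simp
      obtain u where u: "coeffs_in E u" "poly u x * poly r x = 1"
        using less.hyps[OF dr tr(2) r0] less.prems(3) dr by auto
      have "poly r x = - (poly q x * poly t x)" using tr(3) pE(3) by (simp add: add_eq_0_iff)
      hence "poly (- (u * t)) x * poly q x = 1" using u(2) by (simp add: algebra_simps)
      thus ?thesis using coeffs_in_simps(3,4)[OF E] u(1) tr(1) by blast
    qed
  qed
  have invE: "inverse (poly q x) \<in> adjoin E x" if q: "coeffs_in E q" for q
  proof (cases "poly q x = 0")
    case True
    thus ?thesis using adjoin_base[OF E] D(2) by auto
  next
    case False
    obtain t r where tr: "coeffs_in E t" "coeffs_in E r" "q = p * t + r" "r = 0 \<or> degree r < degree p"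
      using subfield_poly_division[OF E q, of p] p unfolding min_poly_def by metis
    have qr: "poly q x = poly r x" using tr(3) p unfolding min_poly_def by simp
    hence "r \<noteq> 0" using False by auto
    then obtain u where "coeffs_in E u" "poly u x * poly r x = 1" using inv tr by blast
    moreover from this have "inverse (poly q x) = poly u x" using qr False
      by (metis inverse_unique mult.commute)
    ultimately show ?thesis unfolding adjoin_def by auto
  qed
  show ?thesis
    unfolding real_subfield_def
  proof (intro conjI ballI)
    show "1 \<in> adjoin E x" using adjoin_base[OF E] D(1) by auto
    fix a assume "a \<in> adjoin E x"
    then obtain q where q: "a = poly q x" "coeffs_in E q" unfolding adjoin_def by auto
    show "inverse a \<in> adjoin E x" using invE[OF q(2)] q(1) by simp
    show "- a \<in> adjoin E x" unfolding adjoin_def q(1)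
      using coeffs_in_simps(4)[OF E q(2)] q(2) by (auto intro!: exI[of _ "- q"])
    fix b assume "b \<in> adjoin E x"
    then obtain q' where q': "b = poly q' x" "coeffs_in E q'" unfolding adjoin_def by auto
    show "a + b \<in> adjoin E x" unfolding adjoin_def q(1) q'(1)
      using coeffs_in_simps(1)[OF E q(2) q'(2)] by (auto intro!: exI[of _ "q + q'"])
    show "a * b \<in> adjoin E x" unfolding adjoin_def q(1) q'(1)
      using coeffs_in_simps(3)[OF E q(2) q'(2)] by (auto intro!: exI[of _ "q * q'"])
  qed
qed

lemma map_poly_embedding:
  assumes E: "real_subfield E" and \<sigma>: "embedding E \<sigma>"
    and pq: "coeffs_in E p" "coeffs_in E q"
  shows "map_poly \<sigma> (p + q) = map_poly \<sigma> p + map_poly \<sigma> q"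
    and "map_poly \<sigma> (p * q) = map_poly \<sigma> p * map_poly \<sigma> q"
    and "map_poly \<sigma> (p - q) = map_poly \<sigma> p - map_poly \<sigma> q"
    and "degree (map_poly \<sigma> p) = degree p"
proof -
  note S = embeddingD[OF E \<sigma>] and D = real_subfieldD[OF E]
  note pq' = pq[unfolded coeffs_in_def]
  have c: "coeff (map_poly \<sigma> r) i = \<sigma> (coeff r i)" for r i by (rule coeff_map_poly) (rule S(2))
  show "map_poly \<sigma> (p + q) = map_poly \<sigma> p + map_poly \<sigma> q"
    by (rule poly_eqI) (use pq' in \<open>simp add: c S(3)\<close>)
  show "map_poly \<sigma> (p - q) = map_poly \<sigma> p - map_poly \<sigma> q"
    by (rule poly_eqI) (use pq' in \<open>simp add: c S(6)\<close>)
  show "map_poly \<sigma> (p * q) = map_poly \<sigma> p * map_poly \<sigma> q"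
  proof (rule poly_eqI)
    fix n
    have "\<sigma> (\<Sum>i\<le>n. coeff p i * coeff q (n - i)) = (\<Sum>i\<le>n. \<sigma> (coeff p i * coeff q (n - i)))"
      by (rule S(8)) (use pq' D(4) in auto)
    thus "coeff (map_poly \<sigma> (p * q)) n = coeff (map_poly \<sigma> p * map_poly \<sigma> q) n"
      using pq' by (simp add: c coeff_mult S(4))
  qed
  show "degree (map_poly \<sigma> p) = degree p"
  proof (cases "p = 0")
    case False
    thus ?thesis by (intro map_poly_degree_eq) (use S(9) pq' in auto)
  qed simp
qed

lemma poly_map_poly_embedding:
  assumes E: "real_subfield E" and \<sigma>: "embedding E \<sigma>" and p: "coeffs_in E p" and x: "x \<in> E"
  shows "poly (map_poly \<sigma> p) (\<sigma> x) = \<sigma> (poly p x)"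
proof -
  note S = embeddingD[OF E \<sigma>] and D = real_subfieldD[OF E]
  note p' = p[unfolded coeffs_in_def]
  have "\<sigma> (poly p x) = (\<Sum>i\<le>degree p. \<sigma> (coeff p i * x ^ i))"
    unfolding poly_altdef by (rule S(8)) (use p' D(4,9) x in auto)
  also have "\<dots> = (\<Sum>i\<le>degree p. \<sigma> (coeff p i) * \<sigma> x ^ i)"
    by (intro sum.cong refl) (use p' D(9) x S(4,7) in auto)
  finally show ?thesis
    unfolding poly_altdef map_poly_embedding(4)[OF E \<sigma> p p] by (simp add: coeff_map_poly S(2))
qed

text \<open>
  The extension sends \<open>q(x)\<close> to \<open>(\<sigma> q)(y)\<close>.  This is well defined, as two polynomials over \<open>E\<close> with the same
  value at \<open>x\<close> differ by a multiple of \<open>p\<close>.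
\<close>

lemma embedding_extend_adjoin:
  fixes \<sigma> :: "real \<Rightarrow> 'b::field_char_0"
  assumes E: "real_subfield E" and \<sigma>: "embedding E \<sigma>" and p: "min_poly E x p"
    and y: "poly (map_poly \<sigma> p) y = 0"
  obtains \<sigma>' where "embedding (adjoin E x) \<sigma>'" "\<And>e. e \<in> E \<Longrightarrow> \<sigma>' e = \<sigma> e" "\<sigma>' x = y"
proof -
  note S = embeddingD[OF E \<sigma>] and D = real_subfieldD[OF E]
  define q where "q = (\<lambda>a. SOME q. coeffs_in E q \<and> poly q x = a)"
  define \<sigma>' where "\<sigma>' = (\<lambda>a. poly (map_poly \<sigma> (q a)) y)"
  have well: "\<sigma>' (poly r x) = poly (map_poly \<sigma> r) y" if r: "coeffs_in E r" for r
  proof -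
    have q: "coeffs_in E (q (poly r x))" "poly (q (poly r x)) x = poly r x"
      using someI[of "\<lambda>q. coeffs_in E q \<and> poly q x = poly r x" r] r unfolding q_def by auto
    have "coeffs_in E (q (poly r x) - r)" "poly (q (poly r x) - r) x = 0"
      using q r coeffs_in_simps(2)[OF E] by auto
    then obtain t where t: "coeffs_in E t" "q (poly r x) - r = p * t" by (rule min_poly_dvd[OF E p])
    have pE: "coeffs_in E p" using p unfolding min_poly_def by auto
    have "map_poly \<sigma> (q (poly r x)) - map_poly \<sigma> r = map_poly \<sigma> p * map_poly \<sigma> t"
      using map_poly_embedding(3)[OF E \<sigma> q(1) r] map_poly_embedding(2)[OF E \<sigma> pE t(1)] t(2) by simp
    hence "poly (map_poly \<sigma> (q (poly r x)) - map_poly \<sigma> r) y = 0" using y by simp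
    thus ?thesis unfolding \<sigma>'_def by simp
  qed
  show thesis
  proof
    show base: "\<sigma>' e = \<sigma> e" if "e \<in> E" for e
    proof -
      have "coeffs_in E [:e:]" using that E by (intro coeffs_in_pCons coeffs_in_0)
      from well[OF this] show ?thesis by (cases "e = 0") (simp_all add: map_poly_pCons S(2))
    qed
    have "coeffs_in E [:0, 1:]" using E D by (intro coeffs_in_pCons coeffs_in_0)
    from well[OF this] show "\<sigma>' x = y" by (simp add: map_poly_pCons S(1,2))
    show "embedding (adjoin E x) \<sigma>'"
      unfolding embedding_def
    proof (intro conjI ballI)
      show "\<sigma>' 1 = 1" using base[OF D(1)] S(1) by simp
      fix a b assume "a \<in> adjoin E x" "b \<in> adjoin E x"
      then obtain f g where fg: "a = poly f x" "b = poly g x" "coeffs_in E f" "coeffs_in E g"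
        unfolding adjoin_def by auto
      note M = map_poly_embedding[OF E \<sigma> fg(3,4)] and W = well[OF coeffs_in_simps(1)[OF E fg(3,4)]]
        well[OF coeffs_in_simps(3)[OF E fg(3,4)]] well[OF fg(3)] well[OF fg(4)]
      show "\<sigma>' (a + b) = \<sigma>' a + \<sigma>' b" using M W fg by simp
      show "\<sigma>' (a * b) = \<sigma>' a * \<sigma>' b" using M W fg by simp
    qed
  qed
qed

text \<open>Number fields inside \<open>\<real>\<close>, described by a finite set of algebraic generators.\<close>

definition real_number_field :: "real set \<Rightarrow> bool" where
  "real_number_field L \<longleftrightarrow> real_subfield L \<and>
     (\<forall>x\<in>L. \<exists>p. coeffs_in \<rat> p \<and> p \<noteq> 0 \<and> poly p x = 0) \<and>
     (\<exists>G. finite G \<and> G \<subseteq> L \<and> (\<forall>E. real_subfield E \<longrightarrow> G \<subseteq> E \<longrightarrow> L \<subseteq> E))"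

lemma real_number_field_min_poly:
  assumes "real_number_field L" "x \<in> L" "real_subfield E"
  obtains p where "min_poly E x p"
proof -
  from assms(1,2) obtain q where q: "coeffs_in \<rat> q" "q \<noteq> 0" "poly q x = 0"
    unfolding real_number_field_def by blast
  have "coeffs_in E q" using q(1) real_subfield_Rats[OF assms(3)] unfolding coeffs_in_def by auto
  thus thesis using min_poly_exists[OF _ q(2,3)] that by blast
qed

text \<open>An embedding extends to \<open>L\<close>, one generator at a time.\<close>

lemma embedding_extend:
  fixes \<sigma> :: "real \<Rightarrow> complex"
  assumes L: "real_number_field L" and E: "real_subfield E" "E \<subseteq> L" and \<sigma>: "embedding E \<sigma>"
  obtains \<tau> where "embedding L \<tau>" "\<And>e. e \<in> E \<Longrightarrow> \<tau> e = \<sigma> e"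
proof -
  from L obtain G where G: "finite G" "G \<subseteq> L" "\<And>F. real_subfield F \<Longrightarrow> G \<subseteq> F \<Longrightarrow> L \<subseteq> F"
    unfolding real_number_field_def by blast
  have Lf: "real_subfield L" using L unfolding real_number_field_def by blast
  have "\<exists>F \<tau>. real_subfield F \<and> E \<subseteq> F \<and> G \<subseteq> F \<and> F \<subseteq> L \<and> embedding F \<tau> \<and> (\<forall>e\<in>E. \<tau> e = \<sigma> e)"
    using G(1,2)
  proof (induction G rule: finite_induct)
    case empty
    thus ?case using E \<sigma> by (intro exI[of _ E] exI[of _ \<sigma>]) auto
  next
    case (insert x G)
    then obtain F \<tau> where F: "real_subfield F" "E \<subseteq> F" "G \<subseteq> F" "F \<subseteq> L" "embedding F \<tau>"
      "\<forall>e\<in>E. \<tau> e = \<sigma> e" by auto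
    obtain p where p: "min_poly F x p"
      using real_number_field_min_poly[OF L _ F(1), of x] insert.prems by auto
    have "degree (map_poly \<tau> p) > 0"
      using map_poly_embedding(4)[OF F(1,5)] p min_poly_degree_pos[OF p] unfolding min_poly_def by auto
    then obtain y where y: "poly (map_poly \<tau> p) y = 0"
      by (metis alg_closed_imp_poly_has_root)
    obtain \<tau>' where \<tau>': "embedding (adjoin F x) \<tau>'" "\<And>e. e \<in> F \<Longrightarrow> \<tau>' e = \<tau> e" "\<tau>' x = y"
      using embedding_extend_adjoin[OF F(1,5) p y] by metis
    show ?case
      using adjoin_subfield[OF F(1) p] adjoin_base[OF F(1), of x] adjoin_elem[OF F(1), of x]
        adjoin_minimal[OF Lf F(4), of x] \<tau>' F insert.prems
      by (intro exI[of _ "adjoin F x"] exI[of _ \<tau>']) auto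
  qed
  then obtain F \<tau> where F: "real_subfield F" "E \<subseteq> F" "G \<subseteq> F" "F \<subseteq> L" "embedding F \<tau>"
      "\<forall>e\<in>E. \<tau> e = \<sigma> e" by blast
  have "F = L" using G(3)[OF F(1,3)] F(4) by auto
  thus thesis using that F by blast
qed

text \<open>Conjugates of \<open>x\<close> over \<open>E\<close> are images of \<open>x\<close> under embeddings of \<open>L\<close> extending \<open>\<sigma>\<close>.\<close>

lemma embedding_extend_root:
  fixes \<sigma> :: "real \<Rightarrow> complex"
  assumes L: "real_number_field L" and E: "real_subfield E" "E \<subseteq> L" and \<sigma>: "embedding E \<sigma>"
    and x: "x \<in> L" and p: "min_poly E x p" and y: "poly (map_poly \<sigma> p) y = 0"
  obtains \<tau> where "embedding L \<tau>" "\<And>e. e \<in> E \<Longrightarrow> \<tau> e = \<sigma> e" "\<tau> x = y"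
proof -
  obtain \<sigma>' where \<sigma>': "embedding (adjoin E x) \<sigma>'" "\<And>e. e \<in> E \<Longrightarrow> \<sigma>' e = \<sigma> e" "\<sigma>' x = y"
    using embedding_extend_adjoin[OF E(1) \<sigma> p y] by metis
  have Lf: "real_subfield L" using L unfolding real_number_field_def by blast
  obtain \<tau> where "embedding L \<tau>" "\<And>e. e \<in> adjoin E x \<Longrightarrow> \<tau> e = \<sigma>' e"
    using embedding_extend[OF L adjoin_subfield[OF E(1) p] adjoin_minimal[OF Lf E(2) x] \<sigma>'(1)] by metis
  thus thesis using that \<sigma>' adjoin_base[OF E(1), of x] adjoin_elem[OF E(1), of x] by (metis subsetD)
qed

section \<open>Rational polynomials and their roots\<close>

text \<open>A rational polynomial as a polynomial over \<open>\<complex>\<close> and over \<open>\<real>\<close>.\<close>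

abbreviation cpoly :: "rat poly \<Rightarrow> complex poly" where "cpoly \<equiv> map_poly of_rat"
abbreviation rpoly :: "rat poly \<Rightarrow> real poly" where "rpoly \<equiv> map_poly of_rat"

lemma of_rat_poly_simps:
  "map_poly of_rat (p + q) = (map_poly of_rat p + map_poly of_rat q :: 'a::field_char_0 poly)"
  "map_poly of_rat (p * q) = (map_poly of_rat p * map_poly of_rat q :: 'a poly)"
  "degree (map_poly of_rat p :: 'a poly) = degree p"
  "lead_coeff (map_poly of_rat p :: 'a poly) = of_rat (lead_coeff p)"
  "coeff (map_poly of_rat p :: 'a poly) i = of_rat (coeff p i)"
  "map_poly of_rat p = (0 :: 'a poly) \<longleftrightarrow> p = 0"
  "poly (map_poly of_rat p) (of_rat x :: 'a) = of_rat (poly p x)"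
  "map_poly of_rat (pderiv p) = pderiv (map_poly of_rat p :: 'a poly)"
proof -
  show *: "coeff (map_poly of_rat p :: 'a poly) i = of_rat (coeff p i)" for p i
    by (simp add: coeff_map_poly)
  show "map_poly of_rat (p + q) = (map_poly of_rat p + map_poly of_rat q :: 'a::field_char_0 poly)"
    by (rule poly_eqI) (simp add: * of_rat_add)
  show mult: "map_poly of_rat (p * q) = (map_poly of_rat p * map_poly of_rat q :: 'a poly)"
    by (rule poly_eqI) (simp add: * coeff_mult of_rat_sum of_rat_mult)
  show deg: "degree (map_poly of_rat p :: 'a poly) = degree p"
    by (rule degree_map_poly) simp
  show "lead_coeff (map_poly of_rat p :: 'a poly) = of_rat (lead_coeff p)"
    by (simp add: * deg)
  show "map_poly of_rat p = (0 :: 'a poly) \<longleftrightarrow> p = 0"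
    by (simp add: poly_eq_iff *)
  show "poly (map_poly of_rat p) (of_rat x :: 'a) = of_rat (poly p x)"
    by (simp add: poly_altdef deg * of_rat_sum of_rat_mult of_rat_power)
  show "map_poly of_rat (pderiv p) = pderiv (map_poly of_rat p :: 'a poly)"
    by (rule poly_eqI) (simp add: * coeff_pderiv of_rat_mult of_rat_add)
qed

text \<open>
  Euclid's algorithm for the resultant: the product of the values of \<open>G\<close> at the roots of \<open>F\<close> is, up
  to rational factors, the product of the values of \<open>F\<close>, hence of \<open>F mod G\<close>, at the roots of \<open>G\<close>.
\<close>

lemma prod_over_roots_rational:
  assumes "F \<noteq> 0" "cpoly F = smult (of_rat (lead_coeff F)) (\<Prod>x\<in>#A. [:-x, 1:])"
  shows "(\<Prod>x\<in>#A. poly (cpoly G) x) \<in> \<rat>"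
  using assms
proof (induction "degree F + degree G" arbitrary: F G A rule: less_induct)
  case less
  have root: "poly (cpoly F) x = 0" if "x \<in># A" for x
    using that by (subst less.prems(2)) (auto simp: poly_prod_mset)
  have lF: "lead_coeff F \<noteq> 0" using less.prems(1) by simp
  consider "degree F = 0" | "degree F > 0" "degree G \<ge> degree F" | "G = 0"
    | "degree F > 0" "degree G < degree F" "G \<noteq> 0" by linarith
  thus ?case
  proof cases
    case 1
    then obtain c where "F = [:c:]" by (auto elim: degree_eq_zeroE)
    hence "A = {#}" using root less.prems(1) by (cases A) (auto simp: map_poly_pCons)
    thus ?thesis by simp
  next
    case 2
    have val: "poly (cpoly G) x = poly (cpoly (G mod F)) x" if "x \<in># A" for x
    proof -
      have "cpoly G = cpoly (F * (G div F)) + cpoly (G mod F)"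
        unfolding of_rat_poly_simps(1)[symmetric] by simp
      thus ?thesis using root[OF that] by (simp add: of_rat_poly_simps)
    qed
    have "degree (G mod F) < degree F" using degree_mod_less'[of F G] 2 less.prems(1)
      by (cases "G mod F = 0") auto
    hence "(\<Prod>x\<in>#A. poly (cpoly (G mod F)) x) \<in> \<rat>"
      using 2 by (intro less.hyps[OF _ less.prems]) auto
    thus ?thesis using val by (simp cong: image_mset_cong)
  next
    case 3
    show ?thesis unfolding 3 by (cases A) auto
  next
    case 4
    have lG: "lead_coeff G \<noteq> 0" using 4 by simp
    obtain B where B: "cpoly G = smult (lead_coeff (cpoly G)) (\<Prod>y\<in>#B. [:-y, 1:])"
      using alg_closed_imp_factorization[of "cpoly G"] 4 by (auto simp: of_rat_poly_simps)
    hence B: "cpoly G = smult (of_rat (lead_coeff G)) (\<Prod>y\<in>#B. [:-y, 1:])"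
      by (simp add: of_rat_poly_simps)
    have Groot: "poly (cpoly G) y = 0" if "y \<in># B" for y
      using that by (subst B) (auto simp: poly_prod_mset)
    have Fval: "(\<Prod>x\<in>#A. y - x) = poly (cpoly F) y / of_rat (lead_coeff F)" for y
      by (subst less.prems(2)) (use lF in \<open>simp add: poly_prod_mset\<close>)
    have mod: "poly (cpoly F) y = poly (cpoly (F mod G)) y" if "y \<in># B" for y
    proof -
      have "cpoly F = cpoly (G * (F div G)) + cpoly (F mod G)"
        unfolding of_rat_poly_simps(1)[symmetric] by simp
      thus ?thesis using Groot[OF that] by (simp add: of_rat_poly_simps)
    qed
    have "degree G + degree (F mod G) < degree F + degree G"
      using degree_mod_less'[of G F] 4 by (cases "F mod G = 0") auto
    hence IH: "(\<Prod>y\<in>#B. poly (cpoly (F mod G)) y) \<in> \<rat>"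
      by (rule less.hyps[OF _ 4(3) B])
    have "(\<Prod>x\<in>#A. poly (cpoly G) x) = (\<Prod>x\<in>#A. of_rat (lead_coeff G) * (\<Prod>y\<in>#B. x - y))"
    proof (intro arg_cong[of _ _ prod_mset] image_mset_cong)
      show "poly (cpoly G) x = of_rat (lead_coeff G) * (\<Prod>y\<in>#B. x - y)" for x
        by (subst B) (simp add: poly_prod_mset)
    qed
    also have "\<dots> = of_rat (lead_coeff G) ^ size A * (\<Prod>x\<in>#A. \<Prod>y\<in>#B. x - y)"
      by (simp add: prod_mset.distrib)
    also have "(\<Prod>x\<in>#A. \<Prod>y\<in>#B. x - y) = (\<Prod>y\<in>#B. \<Prod>x\<in>#A. x - y)"
      by (rule prod_mset.swap)
    also have "\<dots> = (\<Prod>y\<in>#B. (-1) ^ size A * (\<Prod>x\<in>#A. y - x))"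
    proof (intro arg_cong[of _ _ prod_mset] image_mset_cong)
      fix y
      have "(\<Prod>x\<in>#A. x - y) = (\<Prod>x\<in>#A. (-1) * (y - x))" by simp
      also have "\<dots> = (-1) ^ size A * (\<Prod>x\<in>#A. y - x)"
        unfolding prod_mset.distrib by simp
      finally show "(\<Prod>x\<in>#A. x - y) = (-1) ^ size A * (\<Prod>x\<in>#A. y - x)" .
    qed
    also have "\<dots> = (\<Prod>y\<in>#B. ((-1) ^ size A / of_rat (lead_coeff F)) * poly (cpoly (F mod G)) y)"
      by (intro arg_cong[of _ _ prod_mset] image_mset_cong) (simp add: Fval mod)
    also have "\<dots> = ((-1) ^ size A / of_rat (lead_coeff F)) ^ size B * (\<Prod>y\<in>#B. poly (cpoly (F mod G)) y)"
      unfolding prod_mset.distrib by simp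
    finally show ?thesis using IH by auto
  qed
qed

text \<open>\<open>P\<close> is the (monic) minimal polynomial of \<open>x\<close> over \<open>\<rat>\<close>.\<close>

definition rat_min_poly :: "real \<Rightarrow> rat poly \<Rightarrow> bool" where
  "rat_min_poly x P \<longleftrightarrow> lead_coeff P = 1 \<and> poly (rpoly P) x = 0 \<and>
     (\<forall>Q. Q \<noteq> 0 \<longrightarrow> poly (rpoly Q) x = 0 \<longrightarrow> degree P \<le> degree Q)"

lemma coeffs_in_Rats_iff: "coeffs_in \<rat> (p :: real poly) \<longleftrightarrow> (\<exists>P. p = rpoly P)"
proof
  assume "coeffs_in \<rat> p"
  hence "\<forall>i. \<exists>q. coeff p i = of_rat q" unfolding coeffs_in_def Rats_def by auto
  then obtain c where c: "\<And>i. coeff p i = of_rat (c i)" by metis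
  have "p = rpoly (Abs_poly c)"
  proof (rule poly_eqI)
    have "\<forall>i>degree p. c i = 0" using c coeff_eq_0[of p] by (metis of_rat_eq_0_iff)
    thus "coeff p i = coeff (rpoly (Abs_poly c)) i" for i
      using coeff_Abs_poly[of "degree p" c] by (simp add: of_rat_poly_simps c)
  qed
  thus "\<exists>P. p = rpoly P" ..
qed (auto simp: coeffs_in_def of_rat_poly_simps)

lemma rat_min_poly_exists:
  assumes "real_number_field L" "x \<in> L"
  obtains P where "rat_min_poly x P"
proof -
  obtain p where p: "min_poly \<rat> x p"
    using real_number_field_min_poly[OF assms real_subfield_rat] by blast
  then obtain P where P: "p = rpoly P" using coeffs_in_Rats_iff unfolding min_poly_def by blast
  define P' where "P' = smult (inverse (lead_coeff P)) P"
  have nz: "P \<noteq> 0" using p P unfolding min_poly_def by auto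
  have "rpoly P' = smult (of_rat (inverse (lead_coeff P))) (rpoly P)"
    by (rule poly_eqI) (simp add: P'_def of_rat_poly_simps of_rat_mult)
  hence "rat_min_poly x P'"
    unfolding rat_min_poly_def using nz p unfolding min_poly_def P
    by (auto simp: P'_def of_rat_poly_simps coeffs_in_Rats_iff)
  thus thesis by (rule that)
qed

lemma rat_min_poly_imp_min_poly: "rat_min_poly x P \<Longrightarrow> min_poly \<rat> x (rpoly P)"
  unfolding rat_min_poly_def min_poly_def
  by (auto simp: coeffs_in_Rats_iff of_rat_poly_simps)

text \<open>
  A double root would be a root of \<open>gcd P P'\<close>, and one of the two complementary factors of \<open>P\<close> would
  vanish at \<open>x\<close> in a degree below that of \<open>P\<close>.
\<close>

lemma rat_min_poly_roots_simple:
  assumes P: "rat_min_poly x P" shows "rsquarefree (cpoly P)"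
  unfolding rsquarefree_roots
proof (intro allI notI)
  fix r assume r: "poly (cpoly P) r = 0 \<and> poly (pderiv (cpoly P)) r = 0"
  have nz: "P \<noteq> 0" and deg: "degree P > 0"
    using P min_poly_degree_pos[OF rat_min_poly_imp_min_poly[OF P]]
    unfolding rat_min_poly_def by (auto simp: of_rat_poly_simps)
  define D where "D = gcd P (pderiv P)"
  have D0: "D \<noteq> 0" using nz by (simp add: D_def)
  obtain H where H: "P = D * H" unfolding D_def by (meson dvd_def gcd_dvd1)
  have H0: "H \<noteq> 0" using H nz by auto
  obtain u v where uv: "u * P + v * pderiv P = D"
    unfolding D_def using bezout_coefficients_fst_snd by blast
  have "poly (cpoly (u * P + v * pderiv P)) r = 0" using r by (simp add: of_rat_poly_simps)
  hence Dr: "poly (cpoly D) r = 0" unfolding uv .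
  have "degree D > 0"
  proof (rule Nat.gr0I)
    assume "degree D = 0"
    then obtain c where "D = [:c:]" by (auto elim: degree_eq_zeroE)
    thus False using Dr D0 by (simp add: map_poly_pCons)
  qed
  hence "degree H < degree P" using H degree_mult_eq[OF D0 H0] by simp
  hence "poly (rpoly H) x \<noteq> 0" using P H0 unfolding rat_min_poly_def by force
  hence "poly (rpoly D) x = 0" using P H unfolding rat_min_poly_def by (auto simp: of_rat_poly_simps)
  hence "degree P \<le> degree D" using P D0 unfolding rat_min_poly_def by blast
  \<comment> \<open>But \<open>D\<close> divides \<open>pderiv P\<close>.\<close>
  moreover have "pderiv P \<noteq> 0" using deg by (simp add: pderiv_eq_0_iff)
  hence "degree D \<le> degree (pderiv P)" unfolding D_def by (simp add: dvd_imp_degree_le)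
  ultimately show False using deg by (simp add: degree_pderiv)
qed

section \<open>Subfields and dimensions inside the ring of real numbers\<close>

lemma real_ring_simps [simp]:
  "carrier (ring_of_type_algebra :: 'a::Fields.field ring) = UNIV"
  "mult (ring_of_type_algebra :: 'a ring) = (\<lambda>x y. x * y)"
  "one (ring_of_type_algebra :: 'a ring) = 1"
  "zero (ring_of_type_algebra :: 'a ring) = 0"
  "add (ring_of_type_algebra :: 'a ring) = (\<lambda>x y. x + y)"
  unfolding ring_of_type_algebra_def by auto

lemma field_real_ring: "Ring.field (real_ring)"
  by (rule field_from_type_algebra)

lemma real_ring_minus: "a_inv real_ring x = - x"
proof -
  interpret R: Ring.field real_ring by (rule field_real_ring)
  show ?thesis by (rule sym, rule R.sum_zero_eq_neg) auto
qed

lemma real_ring_inverse: "x \<noteq> 0 \<Longrightarrow> m_inv real_ring x = inverse x"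
proof -
  interpret R: Ring.field real_ring by (rule field_real_ring)
  assume "x \<noteq> 0"
  thus ?thesis by (intro R.comm_inv_char) auto
qed

lemma real_subfield_iff: "real_subfield E \<longleftrightarrow> subfield E real_ring"
proof -
  interpret R: Ring.field real_ring by (rule field_real_ring)
  show ?thesis
  proof
    assume E: "real_subfield E"
    note D = real_subfieldD[OF E]
    show "subfield E real_ring"
    proof (rule R.subfieldI')
      show "subring E real_ring"
        by (rule R.subringI) (use D in \<open>auto simp: real_ring_minus\<close>)
      show "inv\<^bsub>real_ring\<^esub> k \<in> E" if "k \<in> E - {\<zero>\<^bsub>real_ring\<^esub>}" for k
        using that D(8) by (auto simp: real_ring_inverse)
    qed
  next
    assume E: "subfield E real_ring"
    note S = subringE[OF subfieldE(1)[OF E]]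
    have inv: "inverse x \<in> E" if "x \<in> E" for x
      using R.subfield_m_inv(1)[OF E, of x] that real_ring_inverse[of x] by (cases "x = 0") auto
    show "real_subfield E"
      unfolding real_subfield_def using S(3,5,6,7) inv by (auto simp: real_ring_minus)
  qed
qed

lemma rat_adjoin_subfield: "real_subfield (rat_adjoin S)"
proof -
  interpret R: Ring.field real_ring by (rule field_real_ring)
  show ?thesis unfolding real_subfield_iff rat_adjoin_def by (rule R.generate_field_is_subfield) auto
qed

lemma rat_adjoin_incl: "S \<subseteq> rat_adjoin S"
  unfolding rat_adjoin_def by (auto intro: generate_field.incl)

lemma rat_adjoin_minimal: "real_subfield E \<Longrightarrow> S \<subseteq> E \<Longrightarrow> rat_adjoin S \<subseteq> E"
proof -
  interpret R: Ring.field real_ring by (rule field_real_ring)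
  assume "real_subfield E" "S \<subseteq> E"
  thus ?thesis unfolding real_subfield_iff rat_adjoin_def by (intro R.generate_field_min_subfield1) auto
qed

lemma embedding_imp_ring_hom:
  "embedding E \<sigma> \<Longrightarrow> \<sigma> \<in> ring_hom (real_ring\<lparr>carrier := E\<rparr>) ring_of_type_algebra"
  unfolding embedding_def by (intro ring_hom_memI) auto

lemma eval_real_ring: "ring.eval real_ring p x = poly (Poly (rev p)) x"
proof -
  interpret R: Ring.field real_ring by (rule field_real_ring)
  have pow: "x [^]\<^bsub>real_ring\<^esub> n = x ^ n" for n :: nat
    by (induction n) (auto simp: R.nat_pow_Suc R.nat_pow_0)
  show ?thesis
    by (induction p) (auto simp: pow Poly_append poly_monom algebra_simps)
qed

text \<open>A basis over \<open>\<rat>\<close> serves as the finite set of generators.\<close>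

lemma finite_dimension_imp_number_field:
  assumes L: "real_subfield L" and fin: "ring.finite_dimension real_ring \<rat> L"
  shows "real_number_field L"
proof -
  interpret R: Ring.field real_ring by (rule field_real_ring)
  have Q: "subfield \<rat> real_ring" using real_subfield_rat real_subfield_iff by blast
  have Ls: "subfield L real_ring" using L real_subfield_iff by blast
  have alg: "\<exists>p. coeffs_in \<rat> p \<and> p \<noteq> 0 \<and> poly p x = 0" if "x \<in> L" for x
  proof -
    have "(R.algebraic over \<rat>) x"
      by (rule R.finite_dimension_imp_algebraic[OF Q subfieldE(1)[OF Ls] fin that])
    then obtain p where p: "p \<in> carrier (\<rat> [X]\<^bsub>real_ring\<^esub>)" "p \<noteq> []" "R.eval p x = \<zero>\<^bsub>real_ring\<^esub>"
      using R.algebraicE[OF subfieldE(1)[OF Q], of x] by auto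
    have pol: "set p \<subseteq> \<rat>" "hd p \<noteq> 0"
      using p(1,2) unfolding univ_poly_carrier[symmetric] polynomial_def by auto
    have "coeff (Poly (rev p)) i \<in> \<rat>" for i
      using pol(1) nth_mem[of i "rev p"] by (auto simp: nth_default_def simp del: nth_mem)
    moreover have "Poly (rev p) \<noteq> 0"
    proof
      assume "Poly (rev p) = 0"
      hence "coeff (Poly (rev p)) (length p - 1) = 0" by simp
      thus False using pol(2) p(2) by (auto simp: nth_default_def rev_nth hd_conv_nth)
    qed
    ultimately show ?thesis using p(3) eval_real_ring[of p x]
      by (intro exI[of _ "Poly (rev p)"]) (auto simp: coeffs_in_def)
  qed
  obtain n where "R.dimension n \<rat> L" using fin unfolding R.finite_dimension_def by auto
  then obtain Vs where Vs: "R.Span \<rat> Vs = L" using R.exists_base[OF Q] by blast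
  have in_span: "set Vs \<subseteq> L" using R.Span_base_incl[OF Q, of Vs] Vs by auto
  have "L \<subseteq> E" if E: "real_subfield E" "set Vs \<subseteq> E" for E
  proof -
    note D = real_subfieldD[OF E(1)]
    have "R.Span \<rat> Us \<subseteq> E" if "set Us \<subseteq> E" for Us
      using that
    proof (induction Us)
      case (Cons u Us)
      hence "R.Span \<rat> Us \<subseteq> E" "u \<in> E" by auto
      thus ?case using D(3,4) real_subfield_Rats[OF E(1)]
        by (auto simp: R.line_extension_mem_iff subset_iff)
    qed (use D(2) in auto)
    from this[OF E(2)] show ?thesis using Vs by simp
  qed
  thus ?thesis unfolding real_number_field_def using L alg in_span by (intro conjI) auto
qed

lemma Span_dimension_le_length:
  assumes "ring R" "subfield K R" "set Us \<subseteq> carrier R"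
  obtains n where "n \<le> length Us" "ring.dimension R n K (ring.Span R K Us)"
proof -
  interpret R: ring R by fact
  note K = assms(2)
  have "\<exists>n. n \<le> length Us \<and> R.dimension n K (R.Span K Us)"
    using assms(3)
  proof (induction Us)
    case Nil
    thus ?case by auto
  next
    case (Cons u Us)
    then obtain n where n: "n \<le> length Us" "R.dimension n K (R.Span K Us)" by auto
    show ?case
    proof (cases "u \<in> R.Span K Us")
      case True
      hence eq: "R.Span K (u # Us) = R.Span K Us"
        using R.Span_base_incl[OF K, of Us] R.Span_base_incl[OF K, of "u # Us"]
          R.mono_Span_subset[OF K, of "u # Us" Us] R.mono_Span[OF K, of Us u] Cons.prems by auto
      show ?thesis unfolding eq using n by (intro exI[of _ n]) simp
    next
      case False
      thus ?thesis using R.Suc_dim[OF _ False n(2)] n(1) Cons.prems by auto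
    qed
  qed
  thus thesis using that by blast
qed

text \<open>A field all of whose elements are \<open>\<rat>\<close>-combinations of the first \<open>n\<close> powers of one element has degree
  at most \<open>n\<close>.\<close>

lemma field_degree_le:
  assumes K: "real_subfield K" and \<alpha>: "\<alpha> \<in> K"
    and gen: "\<And>x. x \<in> K \<Longrightarrow> \<exists>c. (\<forall>i<n. c i \<in> \<rat>) \<and> x = (\<Sum>i<n. c i * \<alpha> ^ i)"
  shows "field_degree K \<le> n"
proof -
  interpret R: Ring.field real_ring by (rule field_real_ring)
  have Q: "subfield \<rat> real_ring" using real_subfield_rat real_subfield_iff by blast
  note D = real_subfieldD[OF K]
  define Us where "Us m = map (\<lambda>i. \<alpha> ^ i) (rev [0..<m])" for m
  have span: "R.Span \<rat> (Us m) = {x. \<exists>c. (\<forall>i<m. c i \<in> \<rat>) \<and> x = (\<Sum>i<m. c i * \<alpha> ^ i)}" for m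
  proof (induction m)
    case 0
    thus ?case by (auto simp: Us_def)
  next
    case (Suc m)
    have *: "R.Span \<rat> (Us (Suc m)) = R.line_extension \<rat> (\<alpha> ^ m) (R.Span \<rat> (Us m))"
      by (simp add: Us_def)
    show ?case
    proof (intro Set.set_eqI iffI)
      fix x assume "x \<in> R.Span \<rat> (Us (Suc m))"
      then obtain k c where kc: "k \<in> \<rat>" "\<forall>i<m. c i \<in> \<rat>" "x = k * \<alpha> ^ m + (\<Sum>i<m. c i * \<alpha> ^ i)"
        unfolding * R.line_extension_mem_iff Suc by auto
      thus "x \<in> {x. \<exists>c. (\<forall>i<Suc m. c i \<in> \<rat>) \<and> x = (\<Sum>i<Suc m. c i * \<alpha> ^ i)}"
        by (intro CollectI exI[of _ "c(m := k)"]) auto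
    next
      fix x assume "x \<in> {x. \<exists>c. (\<forall>i<Suc m. c i \<in> \<rat>) \<and> x = (\<Sum>i<Suc m. c i * \<alpha> ^ i)}"
      then obtain c where "\<forall>i<Suc m. c i \<in> \<rat>" "x = (\<Sum>i<Suc m. c i * \<alpha> ^ i)" by auto
      thus "x \<in> R.Span \<rat> (Us (Suc m))"
        unfolding * R.line_extension_mem_iff Suc
        by - (rule bexI[of _ "c m"], rule bexI[of _ "\<Sum>i<m. c i * \<alpha> ^ i"], auto intro!: exI[of _ c])
    qed
  qed
  have "R.Span \<rat> (Us n) = K"
    unfolding span
  proof (intro Set.set_eqI iffI)
    fix x assume "x \<in> {x. \<exists>c. (\<forall>i<n. c i \<in> \<rat>) \<and> x = (\<Sum>i<n. c i * \<alpha> ^ i)}"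
    then obtain c where "\<forall>i<n. c i \<in> \<rat>" "x = (\<Sum>i<n. c i * \<alpha> ^ i)" by auto
    thus "x \<in> K" using real_subfield_Rats[OF K] by (auto intro!: D(10) D(4) D(9) \<alpha>)
  qed (use gen in blast)
  moreover obtain d where "d \<le> length (Us n)" "R.dimension d \<rat> (R.Span \<rat> (Us n))"
    using Span_dimension_le_length[OF R.ring_axioms Q, of "Us n"] by auto
  ultimately have "d \<le> n" "R.dimension d \<rat> K" by (auto simp: Us_def)
  thus ?thesis unfolding field_degree_def using R.dimI[OF Q] by (auto simp: over_def)
qed

section \<open>Embeddings and algebraic integers\<close>

lemma algebraic_int_diff: "algebraic_int x \<Longrightarrow> algebraic_int y \<Longrightarrow> algebraic_int (x - y)"
  for x y :: "'a::field_char_0"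
  using algebraic_int_plus[of x "- y"] by auto

lemma algebraic_int_of_nat: "algebraic_int (of_nat n)"
  by (rule int_imp_algebraic_int) auto

lemma algebraic_int_prod: "(\<And>i. i \<in> A \<Longrightarrow> algebraic_int (f i)) \<Longrightarrow> algebraic_int (prod f A)"
  for f :: "_ \<Rightarrow> 'a::field_char_0"
  by (induction A rule: infinite_finite_induct) (auto intro: algebraic_int_times int_imp_algebraic_int)

lemma poly_rpoly_embedding:
  fixes \<sigma> :: "real \<Rightarrow> 'b::field_char_0"
  assumes E: "real_subfield E" and \<sigma>: "embedding E \<sigma>" and x: "x \<in> E"
  shows "\<sigma> (poly (rpoly G) x) = poly (map_poly of_rat G) (\<sigma> x)"
proof -
  have "coeffs_in E (rpoly G)"
    using real_subfield_Rats[OF E] by (auto simp: coeffs_in_def of_rat_poly_simps)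
  moreover have "map_poly \<sigma> (rpoly G) = map_poly of_rat G"
    by (rule poly_eqI)
      (simp add: coeff_map_poly embeddingD(2)[OF E \<sigma>] embedding_of_rat[OF E \<sigma>])
  ultimately show ?thesis using poly_map_poly_embedding[OF E \<sigma> _ x] by metis
qed

lemma embedding_algebraic_int:
  fixes \<sigma> :: "real \<Rightarrow> 'b::field_char_0"
  assumes E: "real_subfield E" and \<sigma>: "embedding E \<sigma>" and x: "x \<in> E" "algebraic_int x"
  shows "algebraic_int (\<sigma> x)"
proof -
  obtain f :: "int poly" where f: "poly (map_poly of_int f) x = 0" "lead_coeff f = 1"
    using x(2) unfolding algebraic_int_altdef_ipoly by blast
  have *: "map_poly of_rat (map_poly of_int f) = (map_poly of_int f :: 'c::field_char_0 poly)"
    by (rule poly_eqI) (simp add: coeff_map_poly)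
  have "poly (map_poly of_int f) (\<sigma> x) = \<sigma> (poly (map_poly of_int f) x)"
    using poly_rpoly_embedding[OF E \<sigma> x(1), of "map_poly of_int f"] unfolding * by simp
  thus ?thesis using f embeddingD(2)[OF E \<sigma>] unfolding algebraic_int_altdef_ipoly by auto
qed

lemma embedding_of_real: "embedding E (of_real :: real \<Rightarrow> complex)"
  unfolding embedding_def by auto

lemma of_real_of_rat: "of_real (of_rat q) = (of_rat q :: complex)"
proof -
  obtain a b where "q = of_int a / of_int b"
    by (metis quotient_of_div surjective_pairing)
  thus ?thesis by (simp add: of_rat_divide)
qed

section \<open>Totally real fields with a distinguished generator\<close>

text \<open>
  \<open>K\<close> is a subfield of a totally real number field \<open>L\<close>, and every embedding of \<open>L\<close> that fixes
  \<open>\<alpha> \<in> K\<close> is the identity on \<open>K\<close>.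
\<close>

locale totally_real_pair =
  fixes L K :: "real set" and \<alpha> :: real
  assumes L: "real_number_field L" and K: "real_subfield K" and KL: "K \<subseteq> L"
    and real_valued: "\<And>\<tau> x. embedding L (\<tau> :: real \<Rightarrow> complex) \<Longrightarrow> x \<in> L \<Longrightarrow> \<tau> x \<in> \<real>"
    and \<alpha>: "\<alpha> \<in> K"
    and fixes_\<alpha>: "\<And>\<sigma> x. embedding L (\<sigma> :: real \<Rightarrow> real) \<Longrightarrow> \<sigma> \<alpha> = \<alpha> \<Longrightarrow> x \<in> K \<Longrightarrow> \<sigma> x = x"
begin

lemma subfield_L: "real_subfield L"
  using L unfolding real_number_field_def by blast

lemma Re_embedding:
  assumes "embedding L (\<tau> :: real \<Rightarrow> complex)"
  shows "embedding L (\<lambda>x. Re (\<tau> x))" and "x \<in> L \<Longrightarrow> \<tau> x = of_real (Re (\<tau> x))"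
proof -
  have r: "Im (\<tau> x) = 0" if "x \<in> L" for x
    using real_valued[OF assms that] by (simp add: complex_is_Real_iff)
  show "embedding L (\<lambda>x. Re (\<tau> x))"
    using assms r unfolding embedding_def by simp
  show "x \<in> L \<Longrightarrow> \<tau> x = of_real (Re (\<tau> x))"
    using r by (simp add: complex_eq_iff)
qed

text \<open>The minimal polynomial of \<open>\<alpha>\<close> over \<open>\<rat>\<close>.\<close>

definition P where "P = (SOME P. rat_min_poly \<alpha> P)"

lemma P: "rat_min_poly \<alpha> P"
  unfolding P_def using rat_min_poly_exists[OF L subsetD[OF KL \<alpha>]] someI_ex[of "rat_min_poly \<alpha>"] by blast

lemma P_nonzero: "P \<noteq> 0"
  using P unfolding rat_min_poly_def by auto

text \<open>
  The conjugates of \<open>\<alpha>\<close>.  Only the real roots of \<open>P\<close> are collected; as \<open>L\<close> is totally real, there are no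
  others.
\<close>

definition R where "R = {r :: real. poly (rpoly P) r = 0}"

lemma finite_R: "finite R"
  unfolding R_def by (rule poly_roots_finite) (simp add: of_rat_poly_simps P_nonzero)

lemma \<alpha>_in_R: "\<alpha> \<in> R"
  using P unfolding R_def rat_min_poly_def by blast

lemma root_embedding:
  assumes "poly (cpoly P) y = 0"
  obtains \<sigma> :: "real \<Rightarrow> real" where "embedding L \<sigma>" "y = of_real (\<sigma> \<alpha>)"
proof -
  have "map_poly of_real (rpoly P) = cpoly P"
    by (rule poly_eqI) (simp add: coeff_map_poly of_real_of_rat)
  then obtain \<tau> :: "real \<Rightarrow> complex" where \<tau>: "embedding L \<tau>" "\<tau> \<alpha> = y"
    using embedding_extend_root[OF L real_subfield_rat real_subfield_Rats[OF subfield_L]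
        embedding_of_real[of \<rat>] subsetD[OF KL \<alpha>] rat_min_poly_imp_min_poly[OF P]] assms by metis
  thus thesis using that[of "\<lambda>x. Re (\<tau> x)"] Re_embedding[OF \<tau>(1)] KL \<alpha> by auto
qed

lemma poly_cpoly_of_real: "poly (cpoly G) (of_real x) = of_real (poly (rpoly G) x)"
proof -
  show ?thesis
    by (simp add: poly_altdef of_rat_poly_simps of_real_of_rat)
qed

lemma complex_roots: "{z. poly (cpoly P) z = 0} = of_real ` R"
proof (intro Set.equalityI subsetI)
  fix z assume "z \<in> {z. poly (cpoly P) z = 0}"
  then obtain \<sigma> :: "real \<Rightarrow> real" where "z = of_real (\<sigma> \<alpha>)" "poly (cpoly P) z = 0"
    using root_embedding by blast
  thus "z \<in> of_real ` R" unfolding R_def by (auto simp: poly_cpoly_of_real)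
qed (auto simp: R_def poly_cpoly_of_real)

lemma cpoly_P: "cpoly P = smult (of_rat (lead_coeff P)) (\<Prod>x\<in>#mset_set (of_real ` R). [:-x, 1:])"
proof -
  have "cpoly P = smult (lead_coeff (cpoly P)) (\<Prod>z|poly (cpoly P) z = 0. [:-z, 1:])"
    using complex_poly_decompose_rsquarefree[OF rat_min_poly_roots_simple[OF P]] by simp
  thus ?thesis unfolding complex_roots of_rat_poly_simps
    by (simp add: prod_unfold_prod_mset)
qed

lemma card_R: "card R = degree P"
proof -
  have "degree (cpoly P) = degree (\<Prod>x\<in>of_real ` R. [:-x, 1::complex:])"
    by (subst cpoly_P) (use P_nonzero in \<open>simp add: prod_unfold_prod_mset\<close>)
  also have "\<dots> = (\<Sum>x\<in>of_real ` R. degree [:-x, 1::complex:])"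
    by (rule degree_prod_eq_sum_degree) auto
  also have "\<dots> = card R" by (simp add: card_image inj_on_def)
  finally show ?thesis by (simp add: of_rat_poly_simps)
qed

text \<open>An embedding of \<open>L\<close> for each conjugate of \<open>\<alpha>\<close>.\<close>

definition conjugation :: "real \<Rightarrow> real \<Rightarrow> real" where
  "conjugation r = (SOME \<sigma>. embedding L \<sigma> \<and> \<sigma> \<alpha> = r)"

lemma conjugation:
  assumes "r \<in> R" shows "embedding L (conjugation r)" "conjugation r \<alpha> = r"
proof -
  have "poly (cpoly P) (of_real r) = 0" using assms complex_roots by blast
  then obtain \<sigma> :: "real \<Rightarrow> real" where \<sigma>: "embedding L \<sigma>" "of_real r = (of_real (\<sigma> \<alpha>) :: complex)"
    by (rule root_embedding)
  hence "embedding L \<sigma> \<and> \<sigma> \<alpha> = r" by simp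
  hence "embedding L (conjugation r) \<and> conjugation r \<alpha> = r"
    unfolding conjugation_def by (rule someI[of "\<lambda>\<sigma>. embedding L \<sigma> \<and> \<sigma> \<alpha> = r"])
  thus "embedding L (conjugation r)" "conjugation r \<alpha> = r" by auto
qed

lemma conjugation_\<alpha>: "x \<in> K \<Longrightarrow> conjugation \<alpha> x = x"
  using fixes_\<alpha> conjugation[OF \<alpha>_in_R] by blast

text \<open>
  \<open>K = \<rat>(\<alpha>)\<close>: an element of \<open>K\<close> has no conjugate over \<open>\<rat>(\<alpha>)\<close> but itself.
\<close>

lemma K_generated:
  assumes x: "x \<in> K" obtains G where "x = poly (rpoly G) \<alpha>"
proof -
  let ?F = "adjoin \<rat> \<alpha>"
  have F: "real_subfield ?F" by (rule adjoin_subfield[OF real_subfield_rat rat_min_poly_imp_min_poly[OF P]])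
  have FL: "?F \<subseteq> L"
    using adjoin_minimal[OF subfield_L real_subfield_Rats[OF subfield_L]] KL \<alpha> by blast
  have xL: "x \<in> L" using x KL by blast
  obtain p where p: "min_poly ?F x p" using real_number_field_min_poly[OF L xL F] by blast
  let ?p = "map_poly of_real p :: complex poly"
  have deg: "degree ?p = degree p" and p0: "?p \<noteq> 0"
    using p by (auto simp: min_poly_def degree_map_poly map_poly_eq_0_iff)
  have root: "y = of_real x" if y: "poly ?p y = 0" for y
  proof -
    obtain \<tau> :: "real \<Rightarrow> complex" where \<tau>: "embedding L \<tau>" "\<And>e. e \<in> ?F \<Longrightarrow> \<tau> e = of_real e" "\<tau> x = y"
      using embedding_extend_root[OF L F FL embedding_of_real xL p y] by metis
    have "Re (\<tau> \<alpha>) = \<alpha>" using \<tau>(2)[OF adjoin_elem[OF real_subfield_rat]] by simp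
    hence "Re (\<tau> x) = x" using fixes_\<alpha>[OF Re_embedding(1)[OF \<tau>(1)] _ x] by simp
    thus ?thesis using Re_embedding(2)[OF \<tau>(1) xL] \<tau>(3) by simp
  qed
  obtain A where A: "size A = degree ?p" "?p = smult (lead_coeff ?p) (\<Prod>y\<in>#A. [:-y, 1:])"
    using alg_closed_imp_factorization[OF p0] by blast
  define n where "n = degree p"
  have n: "n > 0" using min_poly_degree_pos[OF p] by (simp add: n_def)
  \<comment> \<open>Now \<open>p\<close> is a multiple of a power of \<open>X - x\<close>, and \<open>x\<close> can be read off from its second coefficient.\<close>
  have Ax: "y = of_real x" if "y \<in># A" for y
  proof (rule root)
    have "poly ?p y = poly (smult (lead_coeff ?p) (\<Prod>y\<in>#A. [:-y, 1:])) y"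
      by (rule arg_cong[OF A(2)])
    also have "\<dots> = 0" using that by (auto simp: poly_prod_mset)
    finally show "poly ?p y = 0" .
  qed
  have "(\<Prod>y\<in>#A. [:-y, 1:]) = (\<Prod>y\<in>#A. [:- of_real x, 1:])"
    by (intro arg_cong[of _ _ prod_mset] image_mset_cong) (simp add: Ax)
  also have "\<dots> = [:- of_real x, 1:] ^ n" using A(1) deg by (simp add: n_def)
  finally have prod: "(\<Prod>y\<in>#A. [:-y, 1:]) = [:- of_real x, 1:] ^ n" .
  have lc: "lead_coeff ?p = of_real (lead_coeff p)" by (simp add: coeff_map_poly deg)
  have p': "?p = smult (of_real (lead_coeff p)) ([:- of_real x, 1:] ^ n)"
    using A(2) unfolding lc prod .
  obtain m where m: "n = Suc m" using n by (cases n) auto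
  have "coeff ?p (n - 1) = of_real (lead_coeff p) * (of_nat n * (- of_real x))"
  proof -
    have "coeff ([:- of_real x, 1 :: complex:] ^ n) m = of_nat n * (- of_real x)"
      unfolding m by (subst coeff_linear_poly_power) (simp_all add: Suc_diff_le)
    thus ?thesis using arg_cong[OF p', of "\<lambda>q. coeff q m"] m by (simp del: power_Suc)
  qed
  hence "complex_of_real (coeff p (n - 1)) = of_real (lead_coeff p * (real n * (- x)))"
    by (simp add: coeff_map_poly)
  hence "coeff p (n - 1) = lead_coeff p * (real n * (- x))" by (simp only: of_real_eq_iff)
  moreover have nz: "lead_coeff p * real n \<noteq> 0" using n p by (simp add: min_poly_def)
  ultimately have "coeff p (n - 1) / (lead_coeff p * real n) = - x"
    by (simp add: nonzero_divide_eq_eq[OF nz])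
  hence eq: "x = - (coeff p (n - 1) / (lead_coeff p * real n))" by simp
  have "coeff p i \<in> ?F" for i using p by (simp add: min_poly_def coeffs_in_def)
  moreover have "real n \<in> ?F" using real_subfield_Rats[OF F] by auto
  ultimately have "- (coeff p (n - 1) / (lead_coeff p * real n)) \<in> ?F"
    by (intro real_subfieldD(4,6,7)[OF F])
  hence "x \<in> ?F" by (simp only: eq[symmetric])
  then obtain q where "x = poly q \<alpha>" "coeffs_in \<rat> q" unfolding adjoin_def by blast
  moreover from this obtain G where "q = rpoly G" using coeffs_in_Rats_iff by blast
  ultimately show thesis using that[of G] by simp
qed

lemma field_degree_K: "field_degree K \<le> card R"
proof (rule field_degree_le[OF K \<alpha>])
  fix x assume "x \<in> K"
  then obtain G where G: "x = poly (rpoly G) \<alpha>" by (rule K_generated)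
  have "rpoly G = rpoly (P * (G div P)) + rpoly (G mod P)"
    unfolding of_rat_poly_simps(1)[symmetric] by simp
  hence "x = poly (rpoly (G mod P)) \<alpha>"
    using G P by (simp add: rat_min_poly_def of_rat_poly_simps)
  moreover have "degree P > 0"
    using min_poly_degree_pos[OF rat_min_poly_imp_min_poly[OF P]] by (simp add: of_rat_poly_simps)
  hence "degree (G mod P) < card R"
    using degree_mod_less'[of P G] P_nonzero unfolding card_R by (cases "G mod P = 0") auto
  ultimately have "x = (\<Sum>i<card R. of_rat (coeff (G mod P) i) * \<alpha> ^ i)"
    by (simp add: poly_altdef of_rat_poly_simps, intro sum.mono_neutral_left)
      (auto simp: coeff_eq_0)
  thus "\<exists>c. (\<forall>i<card R. c i \<in> \<rat>) \<and> x = (\<Sum>i<card R. c i * \<alpha> ^ i)"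
    by (intro exI[of _ "\<lambda>i. of_rat (coeff (G mod P) i)"]) auto
qed

text \<open>The norm of an algebraic integer of \<open>K\<close> is a rational integer.\<close>

lemma norm_Ints:
  assumes \<beta>: "\<beta> \<in> K" "algebraic_int \<beta>"
  shows "(\<Prod>r\<in>R. conjugation r \<beta>) \<in> \<int>"
proof (rule rational_algebraic_int_is_int)
  obtain G where G: "\<beta> = poly (rpoly G) \<alpha>" using K_generated[OF \<beta>(1)] by blast
  have c: "conjugation r \<beta> = poly (rpoly G) r" if "r \<in> R" for r
    using poly_rpoly_embedding[OF subfield_L conjugation(1)[OF that] subsetD[OF KL \<alpha>]] conjugation(2)[OF that] G by simp
  have "complex_of_real (\<Prod>r\<in>R. conjugation r \<beta>) = (\<Prod>z\<in>of_real ` R. poly (cpoly G) z)"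
    by (subst prod.reindex) (auto simp: c poly_cpoly_of_real inj_on_def)
  also have "\<dots> = (\<Prod>z\<in>#mset_set (of_real ` R). poly (cpoly G) z)"
    by (simp add: prod_unfold_prod_mset)
  also have "\<dots> \<in> \<rat>" by (rule prod_over_roots_rational[OF P_nonzero cpoly_P])
  finally obtain q where "complex_of_real (\<Prod>r\<in>R. conjugation r \<beta>) = of_rat q" by (auto simp: Rats_def)
  also have "of_rat q = complex_of_real (of_rat q)" by (simp add: of_real_of_rat)
  finally show "(\<Prod>r\<in>R. conjugation r \<beta>) \<in> \<rat>" by (simp only: of_real_eq_iff) auto
  show "algebraic_int (\<Prod>r\<in>R. conjugation r \<beta>)"
    by (rule algebraic_int_prod, rule embedding_algebraic_int[OF subfield_L conjugation(1)])
      (use KL \<beta> in auto)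
qed

lemma norm_ge_1:
  assumes \<beta>: "\<beta> \<in> K" "algebraic_int \<beta>" "\<beta> \<noteq> 0"
  shows "1 \<le> (\<Prod>r\<in>R. \<bar>conjugation r \<beta>\<bar>)"
proof -
  have "(\<Prod>r\<in>R. conjugation r \<beta>) \<noteq> 0"
    using finite_R embeddingD(9)[OF subfield_L conjugation(1)] KL \<beta> by auto
  with norm_Ints[OF \<beta>(1,2)] have "1 \<le> \<bar>\<Prod>r\<in>R. conjugation r \<beta>\<bar>" by (rule Ints_nonzero_abs_ge1)
  thus ?thesis by (simp add: abs_prod)
qed

text \<open>Apart from \<open>\<beta>\<close> itself, the norm has \<open>card R - 1\<close> factors, one for each conjugate of \<open>\<alpha>\<close> other than \<open>\<alpha>\<close>.\<close>

lemma norm_bound: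
  assumes \<beta>: "\<beta> \<in> K" "algebraic_int \<beta>" "\<beta> \<noteq> 0"
    and c: "\<And>r. r \<in> R \<Longrightarrow> r \<noteq> \<alpha> \<Longrightarrow> \<bar>conjugation r \<beta>\<bar> \<le> c"
  shows "1 \<le> \<bar>\<beta>\<bar> * c ^ (card R - 1)"
proof -
  have "1 \<le> (\<Prod>r\<in>R. \<bar>conjugation r \<beta>\<bar>)" by (rule norm_ge_1[OF \<beta>])
  also have "\<dots> = \<bar>\<beta>\<bar> * (\<Prod>r\<in>R - {\<alpha>}. \<bar>conjugation r \<beta>\<bar>)"
    by (subst prod.remove[OF finite_R \<alpha>_in_R]) (simp add: conjugation_\<alpha>[OF \<beta>(1)])
  also have "\<dots> \<le> \<bar>\<beta>\<bar> * (\<Prod>r\<in>R - {\<alpha>}. c)"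
    by (intro mult_left_mono prod_mono) (use c in auto)
  finally show ?thesis using finite_R \<alpha>_in_R by simp
qed

end

section \<open>Finiteness of algebraic integers of bounded degree and size\<close>

text \<open>
  Nonzero polynomials of degree at most \<open>n\<close> taking integral values of absolute value at most \<open>C\<close> at
  \<open>0, \<dots>, n\<close>; interpolation shows that there are finitely many.
\<close>

definition bounded_integral_polys :: "nat \<Rightarrow> real \<Rightarrow> real poly set" where
  "bounded_integral_polys n C =
     {p. p \<noteq> 0 \<and> degree p \<le> n \<and> (\<forall>q\<le>n. poly p (real q) \<in> \<int> \<and> \<bar>poly p (real q)\<bar> \<le> C)}"

definition bounded_integral_roots :: "nat \<Rightarrow> real \<Rightarrow> real set" where
  "bounded_integral_roots n C = (\<Union>p\<in>bounded_integral_polys n C. {x. poly p x = 0})"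

lemma finite_bounded_integral_polys: "finite (bounded_integral_polys n C)"
proof -
  let ?f = "\<lambda>p. restrict (\<lambda>q. poly p (real q)) {..n}"
  have "inj_on ?f (bounded_integral_polys n C)"
  proof (rule inj_onI)
    fix p p' assume *: "p \<in> bounded_integral_polys n C" "p' \<in> bounded_integral_polys n C" "?f p = ?f p'"
    have val: "poly p (real q) = poly p' (real q)" if "q \<le> n" for q
      using fun_cong[OF *(3), of q] that by simp
    show "p = p'"
    proof (rule poly_eqI_degree)
      show "poly p x = poly p' x" if "x \<in> real ` {..n}" for x using that val by auto
      have "card (real ` {..n}) = Suc n" by (subst card_image) (auto simp: inj_on_def)
      thus "degree p < card (real ` {..n})" "degree p' < card (real ` {..n})"
        using * unfolding bounded_integral_polys_def by auto
    qed
  qed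
  moreover have "?f ` bounded_integral_polys n C \<subseteq> PiE {..n} (\<lambda>_. {x \<in> \<int>. \<bar>x\<bar> \<le> C})"
    unfolding bounded_integral_polys_def by auto
  hence "finite (?f ` bounded_integral_polys n C)"
    by (rule finite_subset) (intro finite_PiE finite_abs_int_segment, simp)
  ultimately show ?thesis by (metis finite_imageD)
qed

lemma finite_bounded_integral_roots: "finite (bounded_integral_roots n C)"
  unfolding bounded_integral_roots_def
  by (intro finite_UN_I finite_bounded_integral_polys poly_roots_finite)
    (auto simp: bounded_integral_polys_def)

context totally_real_pair
begin

text \<open>
  The polynomial with the conjugates of \<open>\<beta>\<close> as its roots takes at an integer \<open>q\<close> the norm of \<open>q - \<beta>\<close> as its
  value.
\<close>

lemma in_bounded_integral_roots:
  assumes \<beta>: "\<beta> \<in> K" "algebraic_int \<beta>" and n: "card R \<le> n" and c: "c \<ge> 1"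
    and bound: "\<And>r. r \<in> R \<Longrightarrow> \<bar>conjugation r \<beta>\<bar> \<le> c"
  shows "\<beta> \<in> bounded_integral_roots n ((real n + c) ^ n)"
proof -
  define p where "p = (\<Prod>r\<in>R. [:- conjugation r \<beta>, 1:])"
  have "poly p \<beta> = 0"
    unfolding p_def poly_prod using finite_R \<alpha>_in_R conjugation_\<alpha>[OF \<beta>(1)] by (auto intro!: bexI[of _ \<alpha>])
  moreover have "p \<in> bounded_integral_polys n ((real n + c) ^ n)"
    unfolding bounded_integral_polys_def
  proof (intro CollectI conjI allI impI)
    show "p \<noteq> 0" unfolding p_def using finite_R by auto
    have "degree p = (\<Sum>r\<in>R. degree [:- conjugation r \<beta>, 1:])"
      unfolding p_def by (rule degree_prod_eq_sum_degree) auto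
    thus "degree p \<le> n" using n by simp
    fix q assume q: "q \<le> n"
    have cq: "conjugation r (real q - \<beta>) = real q - conjugation r \<beta>" if "r \<in> R" for r
    proof -
      note C = conjugation(1)[OF that]
      have "conjugation r (real q) = real q" using embedding_of_rat[OF subfield_L C, of "of_nat q"] by simp
      moreover have "real q \<in> L" using real_subfield_Rats[OF subfield_L] by auto
      ultimately show ?thesis using embeddingD(6)[OF subfield_L C] \<beta> KL by auto
    qed
    have val: "poly p (real q) = (\<Prod>r\<in>R. real q - conjugation r \<beta>)"
      unfolding p_def poly_prod by simp
    also have "\<dots> = (\<Prod>r\<in>R. conjugation r (real q - \<beta>))" by (simp add: cq)
    also have "\<dots> \<in> \<int>"
      using real_subfield_Rats[OF K] \<beta>
      by (intro norm_Ints algebraic_int_diff algebraic_int_of_nat real_subfieldD(5)[OF K]) auto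
    finally show "poly p (real q) \<in> \<int>" .
    have "\<bar>poly p (real q)\<bar> = (\<Prod>r\<in>R. \<bar>real q - conjugation r \<beta>\<bar>)" unfolding val by (simp add: abs_prod)
    also have "\<dots> \<le> (\<Prod>r\<in>R. real n + c)"
    proof (intro prod_mono conjI)
      fix r assume "r \<in> R"
      from bound[OF this] show "\<bar>real q - conjugation r \<beta>\<bar> \<le> real n + c" using q by linarith
    qed auto
    also have "\<dots> \<le> (real n + c) ^ n" using n c by (simp add: power_increasing)
    finally show "\<bar>poly p (real q)\<bar> \<le> (real n + c) ^ n" .
  qed
  ultimately show ?thesis unfolding bounded_integral_roots_def by blast
qed

end

section \<open>Polynomial inequalities\<close>

text \<open>
  If the substitution \<open>z = a + (b - a) / (1 + t)\<close> turns \<open>p\<close> into a polynomial in \<open>t\<close> with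
  nonnegative coefficients (up to a power of \<open>1 + t\<close>), then \<open>p \<ge> 0\<close> on \<open>[a, b]\<close>.
\<close>

lemma poly_nonneg_between:
  fixes p :: "real poly"
  assumes z: "a \<le> z" "z \<le> b" and ab: "a < b"
    and nonneg: "list_all (\<lambda>c. 0 \<le> c) (coeffs (pcompose (reflect_poly (pcompose p [:a, b - a:])) [:1, 1:]))"
  shows "0 \<le> poly p z"
proof -
  note False = ab
  define q where "q = pcompose p [:a, b - a:]"
  define s where "s = pcompose (reflect_poly q) [:1, 1:]"
  have s: "0 \<le> coeff s i" for i
    using nonneg unfolding q_def[symmetric] s_def[symmetric]
    by (cases "i \<le> degree s \<and> s \<noteq> 0") (auto simp: list_all_length coeffs_nth length_coeffs_degree coeff_eq_0)
  define x where "x = (z - a) / (b - a)"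
  have x: "0 \<le> x" "x \<le> 1" using z False by (auto simp: x_def field_simps)
  have "a + x * (b - a) = z" using ab by (simp add: x_def)
  hence pz: "poly p z = poly q x" by (simp add: q_def poly_pcompose)
  show ?thesis
  proof (cases "x = 0")
    case True
    have "coeff q 0 = lead_coeff s" if "coeff q 0 \<noteq> 0"
    proof -
      have "lead_coeff s = lead_coeff (reflect_poly q)"
        unfolding s_def by (subst lead_coeff_comp) auto
      also have "degree (reflect_poly q) = degree q" by (rule degree_reflect_poly_eq[OF that])
      finally show ?thesis by (simp add: coeff_reflect_poly)
    qed
    hence "0 \<le> coeff q 0" using s[of "degree s"] by (cases "coeff q 0 = 0") auto
    thus ?thesis using True pz by (simp add: poly_0_coeff_0)
  next
    case False
    have "0 \<le> poly s (inverse x - 1)"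
      unfolding poly_altdef using s x False by (intro sum_nonneg mult_nonneg_nonneg) (auto simp: field_simps)
    hence "0 \<le> poly (reflect_poly q) (inverse x)" by (simp add: s_def poly_pcompose)
    hence "0 \<le> inverse x ^ degree q * poly q x" using False by (subst (asm) poly_reflect_poly_nz) auto
    moreover have "0 < inverse x ^ degree q" using x False by simp
    ultimately show ?thesis unfolding pz using zero_le_mult_iff[of _ "poly q x"] by fastforce
  qed
qed

text \<open>Rules that compute the transformed polynomial of the previous lemma.\<close>

lemmas bernstein_simps =
  power2_eq_square power3_eq_cube reflect_poly_def cCons_def

text \<open>
  The breakpoints in the following lemmas are chosen so that the criterion above applies on each of the
  intervals.
\<close>

lemma special_value_upper:
  fixes z :: real
  assumes "0 \<le> z" "z \<le> 9/4"
  shows "z^2 * (z - 1)^2 * (2 - z)^3 * (z^2 - 3 * z + 1) \<le> 1/10"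
proof -
  have "0 \<le> poly ([:1/10:] - [:0, 1:]^2 * [:-1, 1:]^2 * [:2, -1:]^3 * [:1, -3, 1:]) z"
  proof -
    consider "z \<in> {0..9/32}" | "z \<in> {9/32..9/16}" | "z \<in> {9/16..9/8}" | "z \<in> {9/8..9/4}"
      using assms by fastforce
    thus ?thesis
    proof cases
      case 1
      thus ?thesis by (intro poly_nonneg_between[of "0" z "9/32"]) (simp_all add: bernstein_simps)
    next
      case 2
      thus ?thesis by (intro poly_nonneg_between[of "9/32" z "9/16"]) (simp_all add: bernstein_simps)
    next
      case 3
      thus ?thesis by (intro poly_nonneg_between[of "9/16" z "9/8"]) (simp_all add: bernstein_simps)
    next
      case 4
      thus ?thesis by (intro poly_nonneg_between[of "9/8" z "9/4"]) (simp_all add: bernstein_simps)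
    qed
  qed
  also have "poly ([:1/10:] - [:0, 1:]^2 * [:-1, 1:]^2 * [:2, -1:]^3 * [:1, -3, 1:]) z =
      1/10 - z^2 * (z - 1)^2 * (2 - z)^3 * (z^2 - 3 * z + 1)"
    by (simp add: field_simps power2_eq_square power3_eq_cube)
  finally show ?thesis by simp
qed

lemma special_value_lower:
  fixes z :: real
  assumes "0 \<le> z" "z \<le> 9/4"
  shows "- (z^2 * (z - 1)^2 * (2 - z)^3 * (z^2 - 3 * z + 1)) \<le> 1/10"
proof -
  have "0 \<le> poly ([:1/10:] + [:0, 1:]^2 * [:-1, 1:]^2 * [:2, -1:]^3 * [:1, -3, 1:]) z"
  proof -
    consider "z \<in> {0..9/16}" | "z \<in> {9/16..9/8}" | "z \<in> {9/8..27/16}" | "z \<in> {27/16..9/4}"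
      using assms by fastforce
    thus ?thesis
    proof cases
      case 1
      thus ?thesis by (intro poly_nonneg_between[of "0" z "9/16"]) (simp_all add: bernstein_simps)
    next
      case 2
      thus ?thesis by (intro poly_nonneg_between[of "9/16" z "9/8"]) (simp_all add: bernstein_simps)
    next
      case 3
      thus ?thesis by (intro poly_nonneg_between[of "9/8" z "27/16"]) (simp_all add: bernstein_simps)
    next
      case 4
      thus ?thesis by (intro poly_nonneg_between[of "27/16" z "9/4"]) (simp_all add: bernstein_simps)
    qed
  qed
  also have "poly ([:1/10:] + [:0, 1:]^2 * [:-1, 1:]^2 * [:2, -1:]^3 * [:1, -3, 1:]) z =
      1/10 + z^2 * (z - 1)^2 * (2 - z)^3 * (z^2 - 3 * z + 1)"
    by (simp add: field_simps power2_eq_square power3_eq_cube)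
  finally show ?thesis by simp
qed

lemma end_value_upper:
  fixes s :: real
  assumes "0 \<le> s" "s \<le> 4"
  shows "s^2 * (s - 2)^2 / 16 * ((4 - s) * (3 - s)) \<le> 14/25"
proof -
  have "0 \<le> poly ([:14/25:] - [:0, 1:]^2 * [:-2, 1:]^2 * [:1/16:] * ([:4, -1:] * [:3, -1:])) s"
  proof -
    consider "s \<in> {0..1}" | "s \<in> {1..2}" | "s \<in> {2..4}"
      using assms by fastforce
    thus ?thesis
    proof cases
      case 1
      thus ?thesis by (intro poly_nonneg_between[of "0" s "1"]) (simp_all add: bernstein_simps)
    next
      case 2
      thus ?thesis by (intro poly_nonneg_between[of "1" s "2"]) (simp_all add: bernstein_simps)
    next
      case 3
      thus ?thesis by (intro poly_nonneg_between[of "2" s "4"]) (simp_all add: bernstein_simps)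
    qed
  qed
  also have "poly ([:14/25:] - [:0, 1:]^2 * [:-2, 1:]^2 * [:1/16:] * ([:4, -1:] * [:3, -1:])) s =
      14/25 - s^2 * (s - 2)^2 / 16 * ((4 - s) * (3 - s))"
    by (simp add: field_simps power2_eq_square power3_eq_cube)
  finally show ?thesis by simp
qed

lemma end_value_lower:
  fixes s :: real
  assumes "0 \<le> s" "s \<le> 4"
  shows "- (s^2 * (s - 2)^2 / 16 * ((4 - s) * (3 - s))) \<le> 14/25"
proof -
  have "0 \<le> poly ([:14/25:] + [:0, 1:]^2 * [:-2, 1:]^2 * [:1/16:] * ([:4, -1:] * [:3, -1:])) s"
  proof -
    consider "s \<in> {0..2}" | "s \<in> {2..3}" | "s \<in> {3..7/2}" | "s \<in> {7/2..4}"
      using assms by fastforce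
    thus ?thesis
    proof cases
      case 1
      thus ?thesis by (intro poly_nonneg_between[of "0" s "2"]) (simp_all add: bernstein_simps)
    next
      case 2
      thus ?thesis by (intro poly_nonneg_between[of "2" s "3"]) (simp_all add: bernstein_simps)
    next
      case 3
      thus ?thesis by (intro poly_nonneg_between[of "3" s "7/2"]) (simp_all add: bernstein_simps)
    next
      case 4
      thus ?thesis by (intro poly_nonneg_between[of "7/2" s "4"]) (simp_all add: bernstein_simps)
    qed
  qed
  also have "poly ([:14/25:] + [:0, 1:]^2 * [:-2, 1:]^2 * [:1/16:] * ([:4, -1:] * [:3, -1:])) s =
      14/25 + s^2 * (s - 2)^2 / 16 * ((4 - s) * (3 - s))"
    by (simp add: field_simps power2_eq_square power3_eq_cube)
  finally show ?thesis by simp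
qed

lemma mid_value_upper:
  fixes s :: real
  assumes "1 \<le> s" "s \<le> 4"
  shows "(s - 1)^2 / 4 * ((4 - s) * (3 - s)) \<le> 14/25"
proof -
  have "0 \<le> poly ([:14/25:] - [:-1, 1:]^2 * [:1/4:] * ([:4, -1:] * [:3, -1:])) s"
  proof -
    consider "s \<in> {1..7/4}" | "s \<in> {7/4..17/8}" | "s \<in> {17/8..5/2}" | "s \<in> {5/2..4}"
      using assms by fastforce
    thus ?thesis
    proof cases
      case 1
      thus ?thesis by (intro poly_nonneg_between[of "1" s "7/4"]) (simp_all add: bernstein_simps)
    next
      case 2
      thus ?thesis by (intro poly_nonneg_between[of "7/4" s "17/8"]) (simp_all add: bernstein_simps)
    next
      case 3
      thus ?thesis by (intro poly_nonneg_between[of "17/8" s "5/2"]) (simp_all add: bernstein_simps)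
    next
      case 4
      thus ?thesis by (intro poly_nonneg_between[of "5/2" s "4"]) (simp_all add: bernstein_simps)
    qed
  qed
  also have "poly ([:14/25:] - [:-1, 1:]^2 * [:1/4:] * ([:4, -1:] * [:3, -1:])) s =
      14/25 - (s - 1)^2 / 4 * ((4 - s) * (3 - s))"
    by (simp add: field_simps power2_eq_square power3_eq_cube)
  finally show ?thesis by simp
qed

lemma mid_value_lower:
  fixes s :: real
  assumes "1 \<le> s" "s \<le> 4"
  shows "- ((s - 1)^2 / 4 * ((4 - s) * (3 - s))) \<le> 14/25"
proof -
  have "0 \<le> poly ([:14/25:] + [:-1, 1:]^2 * [:1/4:] * ([:4, -1:] * [:3, -1:])) s"
  proof -
    consider "s \<in> {1..5/2}" | "s \<in> {5/2..13/4}" | "s \<in> {13/4..4}"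
      using assms by fastforce
    thus ?thesis
    proof cases
      case 1
      thus ?thesis by (intro poly_nonneg_between[of "1" s "5/2"]) (simp_all add: bernstein_simps)
    next
      case 2
      thus ?thesis by (intro poly_nonneg_between[of "5/2" s "13/4"]) (simp_all add: bernstein_simps)
    next
      case 3
      thus ?thesis by (intro poly_nonneg_between[of "13/4" s "4"]) (simp_all add: bernstein_simps)
    qed
  qed
  also have "poly ([:14/25:] + [:-1, 1:]^2 * [:1/4:] * ([:4, -1:] * [:3, -1:])) s =
      14/25 + (s - 1)^2 / 4 * ((4 - s) * (3 - s))"
    by (simp add: field_simps power2_eq_square power3_eq_cube)
  finally show ?thesis by simp
qed

text \<open>The range of \<open>z = x (3 - x)\<close> for \<open>0 \<le> x \<le> 3\<close> is \<open>[0, 9/4]\<close>.\<close>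

lemma auxiliary_bound_3:
  fixes z :: real
  assumes "0 \<le> z" "z \<le> 9/4"
  shows "\<bar>z^2 * (z - 1)^2 * (2 - z)^3 * (z^2 - 3 * z + 1)\<bar> \<le> 1/10"
  using special_value_upper[OF assms] special_value_lower[OF assms] by (simp only: abs_le_iff)

text \<open>
  The range of \<open>z = x (s - x)\<close> for \<open>0 \<le> x \<le> s\<close> is \<open>[0, s\<^sup>2/4]\<close>.  On this interval the function \<open>\<bar>z (z - (s - 1))\<bar>\<close>
  is at most its value at \<open>z = (s - 1)/2\<close> if \<open>z < s - 1\<close>, and its value at the right end otherwise.
\<close>

lemma auxiliary_bound:
  fixes s z :: real
  assumes s: "0 \<le> s" "s \<le> 4" and z: "0 \<le> z" "z \<le> s^2 / 4"
  shows "\<bar>z * (z - (s - 1)) * ((4 - s) * (3 - s))\<bar> \<le> 14/25"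
proof -
  have sq: "s^2 / 4 - (s - 1) = (s - 2)^2 / 4" by (simp add: power2_eq_square field_simps)
  have g: "\<bar>c * ((4 - s) * (3 - s))\<bar> = \<bar>c\<bar> * \<bar>(4 - s) * (3 - s)\<bar>" for c
    by (simp add: abs_mult)
  show ?thesis
  proof (cases "z < s - 1")
    case True
    have "0 \<le> ((s - 1) - 2 * z)^2" by simp
    hence "z * ((s - 1) - z) \<le> (s - 1)^2 / 4" by (simp add: power2_eq_square algebra_simps)
    moreover have "\<bar>z * (z - (s - 1))\<bar> = z * ((s - 1) - z)"
      using True z by (simp add: abs_mult)
    ultimately have "\<bar>z * (z - (s - 1))\<bar> \<le> \<bar>(s - 1)^2 / 4\<bar>" by simp
    hence "\<bar>z * (z - (s - 1)) * ((4 - s) * (3 - s))\<bar> \<le> \<bar>(s - 1)^2 / 4 * ((4 - s) * (3 - s))\<bar>"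
      unfolding g by (rule mult_right_mono) simp
    also have "\<dots> \<le> 14/25"
      using mid_value_upper[of s] mid_value_lower[of s] True z s by (simp only: abs_le_iff)
    finally show ?thesis .
  next
    case False
    have "z * (z - (s - 1)) \<le> s^2 / 4 * (s^2 / 4 - (s - 1))"
      using False z by (intro mult_mono) auto
    also have "\<dots> = s^2 * (s - 2)^2 / 16" unfolding sq by simp
    finally have "\<bar>z * (z - (s - 1))\<bar> \<le> \<bar>s^2 * (s - 2)^2 / 16\<bar>" using False z by simp
    hence "\<bar>z * (z - (s - 1)) * ((4 - s) * (3 - s))\<bar> \<le> \<bar>s^2 * (s - 2)^2 / 16 * ((4 - s) * (3 - s))\<bar>"
      unfolding g by (rule mult_right_mono) simp
    also have "\<dots> \<le> 14/25"
      using end_value_upper[OF s] end_value_lower[OF s] by (simp only: abs_le_iff)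
    finally show ?thesis .
  qed
qed

section \<open>The degree bound\<close>

context totally_real_pair
begin

lemma conjugation_simps:
  assumes "r \<in> R"
  shows "\<And>x y. x \<in> K \<Longrightarrow> y \<in> K \<Longrightarrow> conjugation r (x * y) = conjugation r x * conjugation r y"
    and "\<And>x y. x \<in> K \<Longrightarrow> y \<in> K \<Longrightarrow> conjugation r (x + y) = conjugation r x + conjugation r y"
    and "\<And>x y. x \<in> K \<Longrightarrow> y \<in> K \<Longrightarrow> conjugation r (x - y) = conjugation r x - conjugation r y"
    and "\<And>x n. x \<in> K \<Longrightarrow> conjugation r (x ^ n) = conjugation r x ^ n"
    and "conjugation r 1 = 1" and "\<And>n. conjugation r (numeral n) = numeral n"
proof -
  note E = embeddingD[OF subfield_L conjugation(1)[OF assms]]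
  show "conjugation r (x * y) = conjugation r x * conjugation r y" if "x \<in> K" "y \<in> K" for x y
    using that KL by (intro E) auto
  show "conjugation r (x + y) = conjugation r x + conjugation r y" if "x \<in> K" "y \<in> K" for x y
    using that KL by (intro E) auto
  show "conjugation r (x - y) = conjugation r x - conjugation r y" if "x \<in> K" "y \<in> K" for x y
    using that KL by (intro E) auto
  show "conjugation r (x ^ n) = conjugation r x ^ n" if "x \<in> K" for x n
    using that KL by (intro E) auto
  show "conjugation r 1 = 1" by (rule E)
  show "conjugation r (numeral n) = numeral n" for n
    using embedding_of_rat[OF subfield_L conjugation(1)[OF assms], of "numeral n"] by simp
qed

lemma numeral_K: "numeral n \<in> K" "1 \<in> K"
  using real_subfield_Rats[OF K] by auto

lemma algebraic_int_numeral: "algebraic_int (numeral n :: real)" "algebraic_int (1 :: real)"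
  by (auto intro: int_imp_algebraic_int)

lemma algebraic_int_power: "algebraic_int x \<Longrightarrow> algebraic_int (x ^ n)" for x :: real
  by (induction n) (auto intro: algebraic_int_times algebraic_int_numeral)

text \<open>
  The integer \<open>\<beta>\<close> must not vanish, so the factor \<open>3 - s\<close> is available only if \<open>s \<noteq> 3\<close>.  With \<open>w = - z > 0\<close>
  all factors of \<open>\<beta>\<close> become positive, which shows that \<open>\<beta> \<noteq> 0\<close> and bounds \<open>\<beta>\<close> in terms of \<open>\<alpha> < 196 = 14\<^sup>2\<close>.
  The two numerical inequalities behind the bound \<open>42\<close> are \<open>196\<^bsup>18\<^esup> < 10\<^bsup>42\<^esup>\<close> for \<open>s = 3\<close> and
  \<open>12 \<cdot> 196\<^sup>2 \<cdot> 195 \<cdot> 197 \<cdot> (14/25)\<^bsup>42\<^esup> < 1\<close> for \<open>s \<le> 2\<close>.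
\<close>

lemma degree_bound:
  assumes \<alpha>int: "algebraic_int \<alpha>" and \<alpha>size: "4 < \<alpha>" "\<alpha> < 196"
    and s: "s \<in> K" "algebraic_int s" "0 < s" "s = 3 \<or> s \<le> 2"
    and bound: "\<And>r. r \<in> R \<Longrightarrow> r \<noteq> \<alpha> \<Longrightarrow>
      0 \<le> conjugation r \<alpha> \<and> conjugation r \<alpha> \<le> conjugation r s \<and> conjugation r s \<le> 4"
  shows "card R \<le> 42"
proof (rule ccontr)
  assume "\<not> card R \<le> 42"
  hence N: "42 \<le> card R - 1" by simp
  note DK = real_subfieldD[OF K]
  define z where "z = \<alpha> * (s - \<alpha>)"
  define w where "w = \<alpha> * (\<alpha> - s)"
  have zw: "z = - w" by (simp add: z_def w_def algebra_simps)
  have zK: "z \<in> K" unfolding z_def by (intro DK \<alpha> s)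
  have zint: "algebraic_int z" unfolding z_def by (intro algebraic_int_times algebraic_int_diff \<alpha>int s)
  have cz: "conjugation r z = conjugation r \<alpha> * (conjugation r s - conjugation r \<alpha>)" if "r \<in> R" for r
    unfolding z_def using that \<alpha> s DK by (simp add: conjugation_simps)
  have zbound: "0 \<le> conjugation r z" "conjugation r z \<le> (conjugation r s)^2 / 4"
    if "r \<in> R" "r \<noteq> \<alpha>" for r
  proof -
    show "0 \<le> conjugation r z" using bound[OF that] by (simp add: cz that)
    have "0 \<le> (conjugation r s - 2 * conjugation r \<alpha>)^2" by simp
    thus "conjugation r z \<le> (conjugation r s)^2 / 4"
      by (simp add: cz that power2_eq_square algebra_simps)
  qed
  have w0: "0 < w" unfolding w_def using \<alpha>size s by (intro mult_pos_pos) auto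
  have small: "c ^ (card R - 1) \<le> c ^ 42" if "0 \<le> c" "c \<le> 1" for c :: real
    using N that by (rule power_decreasing)
  from s(4) show False
  proof
    assume s3: "s = 3"
    define \<beta> where "\<beta> = z^2 * (z - 1)^2 * (2 - z)^3 * (z^2 - 3 * z + 1)"
    have "w = \<alpha>^2 - 3 * \<alpha>" by (simp add: w_def s3 power2_eq_square algebra_simps)
    moreover have "\<alpha>^2 \<le> 196^2" using \<alpha>size by (intro power_mono) auto
    ultimately have w: "w + 2 \<le> 196^2" using \<alpha>size by simp
    have \<beta>w: "\<beta> = w^2 * (w + 1)^2 * (w + 2)^3 * (w^2 + 3 * w + 1)"
    proof -
      have "(- w - 1)^2 = (w + 1)^2" by (simp add: power2_eq_square algebra_simps)
      thus ?thesis unfolding \<beta>_def zw by (simp add: add.commute)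
    qed
    have "w^2 + 3 * w + 1 \<le> (w + 2)^2" using w0 by (simp add: power2_eq_square algebra_simps)
    also have "\<dots> \<le> (196^2)^2" using w w0 by (intro power_mono) auto
    finally have \<beta>le: "\<beta> \<le> (196^2)^2 * (196^2)^2 * (196^2)^3 * (196^2)^2"
      unfolding \<beta>w using w w0 by (intro mult_mono power_mono) auto
    have \<beta>0: "\<beta> > 0" unfolding \<beta>w using w0 by (intro mult_pos_pos zero_less_power add_pos_pos) auto
    have "1 \<le> \<bar>\<beta>\<bar> * (1/10) ^ (card R - 1)"
    proof (rule norm_bound)
      show "\<beta> \<in> K" unfolding \<beta>_def by (intro DK zK numeral_K)
      show "algebraic_int \<beta>" unfolding \<beta>_def
        by (intro algebraic_int_times algebraic_int_diff algebraic_int_plus algebraic_int_power zint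
            algebraic_int_numeral)
      show "\<beta> \<noteq> 0" using \<beta>0 by simp
      fix r assume r: "r \<in> R" "r \<noteq> \<alpha>"
      let ?z = "conjugation r z"
      have "conjugation r \<beta> = ?z^2 * (?z - 1)^2 * (2 - ?z)^3 * (?z^2 - 3 * ?z + 1)"
        unfolding \<beta>_def using r zK numeral_K by (simp add: conjugation_simps DK)
      moreover have "?z \<le> 9/4" using zbound(2)[OF r] r by (simp add: s3 conjugation_simps)
      ultimately show "\<bar>conjugation r \<beta>\<bar> \<le> 1/10"
        using auxiliary_bound_3[OF zbound(1)[OF r]] by metis
    qed
    also have "\<dots> \<le> ((196^2)^2 * (196^2)^2 * (196^2)^3 * (196^2)^2) * (1/10) ^ 42"
      using \<beta>le \<beta>0 small[of "1/10"] by (intro mult_mono) auto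
    also have "\<dots> < 1" by (simp add: power_divide)
    finally show False by simp
  next
    assume s2: "s \<le> 2"
    define \<beta> where "\<beta> = z * (z - (s - 1)) * ((4 - s) * (3 - s))"
    have w: "w \<le> 196 * 196" unfolding w_def using \<alpha>size s by (intro mult_mono) auto
    have ws: "w + (s - 1) = (\<alpha> - 1) * (\<alpha> + 1 - s)" by (simp add: w_def algebra_simps)
    have ws_le: "w + (s - 1) \<le> 195 * 197" unfolding ws using \<alpha>size s s2 by (intro mult_mono) auto
    have ws0: "0 < w + (s - 1)" unfolding ws using \<alpha>size s2 by (intro mult_pos_pos) auto
    have \<beta>w: "\<beta> = w * (w + (s - 1)) * ((4 - s) * (3 - s))"
      unfolding \<beta>_def zw by (simp add: algebra_simps)
    have "(4 - s) * (3 - s) \<le> 4 * 3" using s s2 by (intro mult_mono) auto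
    hence \<beta>le: "\<beta> \<le> (196 * 196) * (195 * 197) * (4 * 3)"
      unfolding \<beta>w using w ws_le w0 ws0 s2 s(3) by (intro mult_mono) auto
    have \<beta>0: "\<beta> > 0" unfolding \<beta>w using w0 ws0 s2 by (intro mult_pos_pos) auto
    have "1 \<le> \<bar>\<beta>\<bar> * (14/25) ^ (card R - 1)"
    proof (rule norm_bound)
      show "\<beta> \<in> K" unfolding \<beta>_def by (intro DK zK s numeral_K)
      show "algebraic_int \<beta>" unfolding \<beta>_def
        by (intro algebraic_int_times algebraic_int_diff zint s algebraic_int_numeral)
      show "\<beta> \<noteq> 0" using \<beta>0 by simp
      fix r assume r: "r \<in> R" "r \<noteq> \<alpha>"
      let ?z = "conjugation r z" and ?s = "conjugation r s"
      have "conjugation r \<beta> = ?z * (?z - (?s - 1)) * ((4 - ?s) * (3 - ?s))"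
        unfolding \<beta>_def using r zK s numeral_K by (simp add: conjugation_simps DK)
      moreover have "0 \<le> ?s" "?s \<le> 4" using bound[OF r] by auto
      ultimately show "\<bar>conjugation r \<beta>\<bar> \<le> 14/25"
        using auxiliary_bound[OF _ _ zbound[OF r]] by metis
    qed
    also have "\<dots> \<le> ((196 * 196) * (195 * 197) * (4 * 3)) * (14/25) ^ 42"
      using \<beta>le \<beta>0 small[of "14/25"] by (intro mult_mono) auto
    also have "\<dots> < 1" by (simp add: power_divide)
    finally show False by simp
  qed
qed

end

section \<open>Gram matrices containing a star with two edges\<close>

lemma neg_semidef_supported:
  assumes "finite P" "S \<subseteq> P" "neg_semidef P a"
  shows "(\<Sum>i\<in>S. \<Sum>j\<in>S. x i * a i j * x j) \<le> 0"
proof -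
  let ?y = "\<lambda>i. if i \<in> S then x i else 0"
  have "(\<Sum>i\<in>P. \<Sum>j\<in>P. ?y i * a i j * ?y j) = (\<Sum>i\<in>S. \<Sum>j\<in>P. ?y i * a i j * ?y j)"
    by (rule sum.mono_neutral_right) (use assms in auto)
  also have "\<dots> = (\<Sum>i\<in>S. \<Sum>j\<in>S. ?y i * a i j * ?y j)"
    by (intro sum.cong refl sum.mono_neutral_right) (use assms in auto)
  also have "\<dots> = (\<Sum>i\<in>S. \<Sum>j\<in>S. x i * a i j * x j)"
    by (intro sum.cong refl) simp
  finally show ?thesis
    using assms(3)[unfolded neg_semidef_def, THEN spec, of ?y] by linarith
qed

lemma neg_semidef_pair:
  assumes P: "finite P" "neg_semidef P a" and uv: "u \<in> P" "v \<in> P" "u \<noteq> v"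
    and a: "a u u = -2" "a v v = -2" "a v u = a u v"
  shows "(a u v)^2 \<le> 4"
proof -
  have *: "(\<Sum>i\<in>{u, v}. \<Sum>j\<in>{u, v}. (if i = u then 1 else t) * a i j * (if j = u then 1 else t)) \<le> 0" for t
    by (rule neg_semidef_supported[OF P(1) _ P(2)]) (use uv in auto)
  have "\<bar>a u v\<bar> \<le> 2" using *[of 1] *[of "-1"] uv(3) a by simp
  hence "\<bar>a u v\<bar>^2 \<le> 2^2" by (intro power_mono) auto
  thus ?thesis by simp
qed

text \<open>The vector \<open>2 u + a\<^sub>u\<^sub>v v + a\<^sub>u\<^sub>w w\<close> tests the determinant of the star with centre \<open>u\<close>.\<close>

lemma neg_semidef_star:
  assumes P: "finite P" "neg_semidef P a" and uvw: "u \<in> P" "v \<in> P" "w \<in> P" "u \<noteq> v" "u \<noteq> w" "v \<noteq> w"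
    and a: "a u u = -2" "a v v = -2" "a w w = -2" "a v u = a u v" "a w u = a u w" "a v w = 0" "a w v = 0"
  shows "(a u v)^2 + (a u w)^2 \<le> 4"
proof -
  let ?x = "\<lambda>i. if i = u then 2 else a u i"
  have "(\<Sum>i\<in>{u, v, w}. \<Sum>j\<in>{u, v, w}. ?x i * a i j * ?x j) \<le> 0"
    by (rule neg_semidef_supported[OF P(1) _ P(2)]) (use uvw in auto)
  thus ?thesis using uvw(4-6) a by (simp add: power2_eq_square algebra_simps)
qed

lemma cyclic_product_square:
  assumes "x \<in> P" "y \<in> P" "a y x = a x y"
  shows "(a x y)^2 \<in> cyclic_products P a"
  unfolding cyclic_products_def using assms
  by (intro CollectI exI[of _ "[x, y]"]) (auto simp: power2_eq_square lessThan_Suc)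

lemma ground_field_subset_entry_field: "ground_field P a \<subseteq> entry_field P a"
proof -
  have E: "real_subfield (entry_field P a)" unfolding entry_field_def by (rule rat_adjoin_subfield)
  have entry: "a i j \<in> entry_field P a" if "i \<in> P" "j \<in> P" for i j
    using that rat_adjoin_incl[of "{a i j |i j. i \<in> P \<and> j \<in> P}"] unfolding entry_field_def by blast
  have prod: "prod f A \<in> entry_field P a" if "\<And>i. i \<in> A \<Longrightarrow> f i \<in> entry_field P a" for f :: "nat \<Rightarrow> real" and A
    using that by (induction A rule: infinite_finite_induct) (auto intro: real_subfieldD[OF E])
  have "cyclic_products P a \<subseteq> entry_field P a"
    unfolding cyclic_products_def
    by (auto intro!: prod entry)
  thus ?thesis unfolding ground_field_def by (rule rat_adjoin_minimal[OF E])
qed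

lemma cos_pi_div_nonneg:
  assumes "k \<ge> 2" shows "0 \<le> cos (pi / real k)"
proof (rule cos_ge_zero)
  show "pi / real k \<le> pi / 2" using assms by (intro divide_left_mono) auto
  have "0 \<le> pi / real k" by simp
  thus "- (pi / 2) \<le> pi / real k" using pi_gt_zero by linarith
qed

text \<open>The value is \<open>4 sin\<^sup>2 (\<pi>/m)\<close>, which decreases in \<open>m\<close> and equals \<open>3\<close> and \<open>2\<close> for \<open>m = 3\<close> and \<open>m = 4\<close>.\<close>

lemma four_minus_cos_square:
  assumes "m \<ge> 3"
  shows "0 < 4 - (2 * cos (pi / real m))^2"
    and "4 - (2 * cos (pi / real m))^2 = 3 \<or> 4 - (2 * cos (pi / real m))^2 \<le> 2"
proof -
  have s: "4 - (2 * cos (pi / real m))^2 = 4 * (sin (pi / real m))^2"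
    by (simp add: power_mult_distrib sin_squared_eq)
  have "0 < sin (pi / real m)" using assms by (intro sin_gt_zero) (auto simp: field_simps)
  thus "0 < 4 - (2 * cos (pi / real m))^2" unfolding s by simp
  show "4 - (2 * cos (pi / real m))^2 = 3 \<or> 4 - (2 * cos (pi / real m))^2 \<le> 2"
  proof (cases "m = 3")
    case True
    thus ?thesis by (simp add: cos_60)
  next
    case False
    hence "pi / real m \<le> pi / 4" using assms by (intro divide_left_mono) auto
    hence "cos (pi / 4) \<le> cos (pi / real m)"
      by (intro cos_monotone_0_pi_le) auto
    hence "(cos (pi / 4))^2 \<le> (cos (pi / real m))^2"
      by (intro power_mono) (auto simp: cos_45)
    thus ?thesis by (simp add: cos_45 power_divide power_mult_distrib)
  qed
qed

text \<open>
  A finite set that contains all entries of the Gram matrices under consideration: \<open>-2\<close> for the diagonal,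
  and square roots of numbers among which are all algebraic integers of a totally real field of degree
  at most \<open>42\<close> with all conjugates at most \<open>196\<close> in absolute value.
\<close>

definition gram_entries :: "real set" where
  "gram_entries = insert (-2) (sqrt ` bounded_integral_roots 42 ((real 42 + 196) ^ 42))"

lemma finite_gram_entries: "finite gram_entries"
  unfolding gram_entries_def by (simp add: finite_bounded_integral_roots)

text \<open>
  The element \<open>\<alpha> = a\<^sub>u\<^sub>v\<^sup>2\<close> is more than \<open>4\<close>, while an embedding that moves some element of the ground field
  takes the square of every entry into \<open>[0, 4]\<close>.  Hence an embedding that fixes \<open>\<alpha>\<close> fixes the ground field.
\<close>

lemma star_graph_bounds:
  fixes a :: "'v \<Rightarrow> 'v \<Rightarrow> real"
  assumes arith: "V_arithmetic P a" and minimal: "has_minimality 14 P a"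
    and sym: "\<And>x y. a x y = a y x"
    and diag: "\<And>x. x \<in> P \<Longrightarrow> a x x = -2"
    and off: "\<And>x y. x \<in> P \<Longrightarrow> y \<in> P \<Longrightarrow> x \<noteq> y \<Longrightarrow> 0 \<le> a x y"
    and uvw: "u \<in> P" "v \<in> P" "w \<in> P"
    and uv: "2 < a u v" and vw: "a v w = 0" and m: "m \<ge> 3" and uw: "a u w = 2 * cos (pi / real m)"
  shows "field_degree (ground_field P a) \<le> 42"
    and "\<And>x y. x \<in> P \<Longrightarrow> y \<in> P \<Longrightarrow> a x y \<in> gram_entries"
proof -
  define L where "L = entry_field P a"
  define K where "K = ground_field P a"
  define \<alpha> where "\<alpha> = (a u v)^2"
  define s where "s = 4 - (a u w)^2"
  have fin: "finite P" using arith unfolding V_arithmetic_def by blast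
  have L: "real_subfield L" unfolding L_def entry_field_def by (rule rat_adjoin_subfield)
  have K: "real_subfield K" unfolding K_def ground_field_def by (rule rat_adjoin_subfield)
  have KL: "K \<subseteq> L" unfolding K_def L_def by (rule ground_field_subset_entry_field)
  have NL: "real_number_field L" using arith
    by (intro finite_dimension_imp_number_field[OF L])
      (auto simp: V_arithmetic_def totally_real_number_field_def L_def)
  have entry: "a x y \<in> L" if "x \<in> P" "y \<in> P" for x y
    using that rat_adjoin_incl[of "{a i j |i j. i \<in> P \<and> j \<in> P}"] unfolding L_def entry_field_def by blast
  have square: "(a x y)^2 \<in> K" "algebraic_int ((a x y)^2)" if "x \<in> P" "y \<in> P" for x y
  proof -
    have "(a x y)^2 \<in> cyclic_products P a" using that sym by (rule cyclic_product_square)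
    thus "(a x y)^2 \<in> K" "algebraic_int ((a x y)^2)"
      using arith rat_adjoin_incl[of "cyclic_products P a"]
      unfolding V_arithmetic_def K_def ground_field_def by auto
  qed
  have semidef: "neg_semidef P (\<lambda>i j. \<sigma> (a i j))"
    if "embedding L \<sigma>" "x \<in> K" "\<sigma> x \<noteq> x" for \<sigma> :: "real \<Rightarrow> real" and x
    using arith embedding_imp_ring_hom[OF that(1)] that(2,3)
    unfolding V_arithmetic_def L_def K_def by blast
  have minus2: "\<sigma> (-2) = -2" if "embedding L \<sigma>" for \<sigma> :: "real \<Rightarrow> real"
    using embedding_of_rat[OF L that, of "-2"] by simp
  have square_le: "\<sigma> ((a x y)^2) \<le> 4"
    if \<sigma>: "embedding L \<sigma>" and moved: "z \<in> K" "\<sigma> z \<noteq> z" and xy: "x \<in> P" "y \<in> P"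
    for \<sigma> :: "real \<Rightarrow> real" and x y z
  proof (cases "x = y")
    case True
    thus ?thesis using diag[OF xy(1)] embedding_of_rat[OF L \<sigma>, of 4] by simp
  next
    case False
    show ?thesis
      using neg_semidef_pair[OF fin semidef[OF \<sigma> moved] xy False] diag xy sym minus2[OF \<sigma>]
        embeddingD(7)[OF L \<sigma> entry[OF xy]] by simp
  qed
  have range: "a x y < 14" if "x \<in> P" "y \<in> P" for x y
    using that minimal unfolding has_minimality_def by blast
  have \<alpha>size: "4 < \<alpha>" "\<alpha> < 196"
  proof -
    have "2^2 < (a u v)^2" "(a u v)^2 < 14^2"
      using uv range[OF uvw(1,2)] by (intro power_strict_mono; simp)+
    thus "4 < \<alpha>" "\<alpha> < 196" by (simp_all add: \<alpha>_def)
  qed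
  have \<alpha>K: "\<alpha> \<in> K" unfolding \<alpha>_def by (rule square[OF uvw(1,2)])
  have neq: "u \<noteq> v" "u \<noteq> w" "v \<noteq> w"
  proof -
    show "u \<noteq> v" using uv diag[OF uvw(1)] by auto
    show "v \<noteq> w" using vw diag[OF uvw(2)] by auto
    show "u \<noteq> w" using uw diag[OF uvw(1)] cos_pi_div_nonneg[of m] m by auto
  qed
  have real_valued: "\<tau> x \<in> \<real>" if \<tau>: "embedding L \<tau>" and x: "x \<in> L" for \<tau> :: "real \<Rightarrow> complex" and x
  proof -
    have "totally_real_number_field L" using arith unfolding V_arithmetic_def L_def by blast
    thus ?thesis using embedding_imp_ring_hom[OF \<tau>] x unfolding totally_real_number_field_def by blast
  qed
  interpret totally_real_pair L K \<alpha>
  proof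
    fix \<sigma> :: "real \<Rightarrow> real" and x
    assume *: "embedding L \<sigma>" "\<sigma> \<alpha> = \<alpha>" "x \<in> K"
    show "\<sigma> x = x"
    proof (rule ccontr)
      assume "\<sigma> x \<noteq> x"
      from square_le[OF *(1,3) this uvw(1,2)] have "\<sigma> \<alpha> \<le> 4" by (simp add: \<alpha>_def)
      thus False using *(2) \<alpha>size by simp
    qed
  qed (fact NL K KL \<alpha>K real_valued)+
  have sK: "s \<in> K" "algebraic_int s"
    unfolding s_def using square[OF uvw(1,3)] real_subfieldD(5)[OF K] numeral_K
    by (auto intro!: algebraic_int_diff algebraic_int_numeral)
  have moved: "conjugation r \<alpha> \<noteq> \<alpha>" if "r \<in> R" "r \<noteq> \<alpha>" for r
    using that conjugation(2) by simp
  have card: "card R \<le> 42"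
  proof (rule degree_bound)
    show "algebraic_int \<alpha>" unfolding \<alpha>_def by (rule square[OF uvw(1,2)])
    show "0 < s" "s = 3 \<or> s \<le> 2" unfolding s_def uw by (rule four_minus_cos_square[OF m])+
    fix r assume r: "r \<in> R" "r \<noteq> \<alpha>"
    let ?\<sigma> = "conjugation r"
    note \<sigma> = conjugation(1)[OF r(1)]
    have sq: "?\<sigma> ((a x y)^2) = (?\<sigma> (a x y))^2" if "x \<in> P" "y \<in> P" for x y
      by (rule embeddingD(7)[OF subfield_L \<sigma> entry[OF that]])
    have "(?\<sigma> (a u v))^2 + (?\<sigma> (a u w))^2 \<le> 4"
      by (rule neg_semidef_star[OF fin semidef[OF \<sigma> \<alpha>K moved[OF r]] uvw neq])
        (use diag uvw sym vw minus2[OF \<sigma>] embeddingD(2)[OF subfield_L \<sigma>] in auto)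
    moreover have "?\<sigma> s = 4 - (?\<sigma> (a u w))^2"
      unfolding s_def using r square[OF uvw(1,3)] numeral_K
      by (simp add: conjugation_simps sq[OF uvw(1,3)])
    moreover have "?\<sigma> \<alpha> = (?\<sigma> (a u v))^2"
      using sq[OF uvw(1,2)] by (simp only: \<alpha>_def)
    ultimately show "0 \<le> ?\<sigma> \<alpha> \<and> ?\<sigma> \<alpha> \<le> ?\<sigma> s \<and> ?\<sigma> s \<le> 4"
      by simp
  qed (fact \<alpha>size sK)+
  thus "field_degree (ground_field P a) \<le> 42"
    using field_degree_K by (simp add: K_def)
  show "a x y \<in> gram_entries" if xy: "x \<in> P" "y \<in> P" for x y
  proof (cases "x = y")
    case True
    thus ?thesis using diag xy unfolding gram_entries_def by simp
  next
    case False
    note nonneg = off[OF xy False]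
    have "(a x y)^2 \<in> bounded_integral_roots 42 ((real 42 + 196) ^ 42)"
    proof (rule in_bounded_integral_roots[OF square[OF xy] card])
      fix r assume r: "r \<in> R"
      show "\<bar>conjugation r ((a x y)^2)\<bar> \<le> 196"
      proof (cases "r = \<alpha>")
        case True
        have "(a x y)^2 \<le> 14^2" using nonneg range[OF xy] by (intro power_mono) auto
        thus ?thesis using True conjugation_\<alpha>[OF square(1)[OF xy]] by simp
      next
        case False
        note \<sigma> = conjugation(1)[OF r]
        have "0 \<le> conjugation r ((a x y)^2)" by (simp add: embeddingD(7)[OF subfield_L \<sigma> entry[OF xy]])
        thus ?thesis using square_le[OF \<sigma> \<alpha>K moved[OF r False] xy] by simp
      qed
    qed simp
    moreover have "a x y = sqrt ((a x y)^2)" using nonneg by simp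
    ultimately show ?thesis unfolding gram_entries_def by blast
  qed
qed

section \<open>Finitely many Gram matrices\<close>

text \<open>The Gram matrix with respect to an enumeration of the vertices, as a list of rows.\<close>

definition gram_list :: "('v \<Rightarrow> 'v \<Rightarrow> real) \<Rightarrow> 'v list \<Rightarrow> real list list" where
  "gram_list B xs = map (\<lambda>x. map (B x) xs) xs"

lemma gram_list_eq_imp_iso:
  assumes "distinct xs" "distinct ys" "gram_list B xs = gram_list B ys"
  obtains f where "bij_betw f (set xs) (set ys)" "\<And>x y. x \<in> set xs \<Longrightarrow> y \<in> set xs \<Longrightarrow> B (f x) (f y) = B x y"
proof -
  have len: "length xs = length ys" using arg_cong[OF assms(3), of length] by (simp add: gram_list_def)
  have eq: "B (xs ! i) (xs ! j) = B (ys ! i) (ys ! j)" if "i < length xs" "j < length xs" for i j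
    using arg_cong[OF assms(3), of "\<lambda>A. A ! i ! j"] that len by (simp add: gram_list_def)
  let ?I = "{..<length xs}"
  have bx: "bij_betw (\<lambda>i. xs ! i) ?I (set xs)" by (rule bij_betw_nth[OF assms(1)]) auto
  have by': "bij_betw (\<lambda>i. ys ! i) ?I (set ys)" by (rule bij_betw_nth[OF assms(2)]) (auto simp: len)
  define g where "g = the_inv_into ?I (\<lambda>i. xs ! i)"
  have g: "bij_betw g (set xs) ?I" unfolding g_def by (rule bij_betw_the_inv_into[OF bx])
  have gx: "xs ! g x = x" "g x < length xs" if "x \<in> set xs" for x
  proof -
    show "xs ! g x = x" using f_the_inv_into_f_bij_betw[OF bx, of x] that unfolding g_def by simp
    show "g x < length xs" using g that by (auto simp: bij_betw_def)
  qed
  show thesis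
  proof (rule that)
    show "bij_betw ((\<lambda>i. ys ! i) \<circ> g) (set xs) (set ys)" by (rule bij_betw_trans[OF g by'])
    fix x y assume "x \<in> set xs" "y \<in> set xs"
    thus "B (((\<lambda>i. ys ! i) \<circ> g) x) (((\<lambda>i. ys ! i) \<circ> g) y) = B x y"
      using eq[of "g x" "g y"] gx by simp
  qed
qed

lemma gram_graph_iso_sym: "(P, Q) \<in> gram_graph_iso B \<Longrightarrow> (Q, P) \<in> gram_graph_iso B"
proof -
  assume "(P, Q) \<in> gram_graph_iso B"
  then obtain f where f: "bij_betw f P Q" "\<And>x y. x \<in> P \<Longrightarrow> y \<in> P \<Longrightarrow> B (f x) (f y) = B x y"
    unfolding gram_graph_iso_def by blast
  have g: "bij_betw (the_inv_into P f) Q P" by (rule bij_betw_the_inv_into[OF f(1)])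
  have "B (the_inv_into P f x) (the_inv_into P f y) = B x y" if "x \<in> Q" "y \<in> Q" for x y
  proof -
    have "f (the_inv_into P f x) = x" "f (the_inv_into P f y) = y"
      using f_the_inv_into_f_bij_betw[OF f(1)] that by auto
    thus ?thesis
      using f(2)[of "the_inv_into P f x" "the_inv_into P f y"] bij_betw_apply[OF g] that by simp
  qed
  thus ?thesis unfolding gram_graph_iso_def using g by blast
qed

lemma gram_graph_iso_trans:
  "(P, Q) \<in> gram_graph_iso B \<Longrightarrow> (Q, T) \<in> gram_graph_iso B \<Longrightarrow> (P, T) \<in> gram_graph_iso B"
proof -
  assume "(P, Q) \<in> gram_graph_iso B" "(Q, T) \<in> gram_graph_iso B"
  then obtain f g where "bij_betw f P Q" "\<And>x y. x \<in> P \<Longrightarrow> y \<in> P \<Longrightarrow> B (f x) (f y) = B x y"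
    "bij_betw g Q T" "\<And>x y. x \<in> Q \<Longrightarrow> y \<in> Q \<Longrightarrow> B (g x) (g y) = B x y"
    unfolding gram_graph_iso_def by blast
  thus ?thesis unfolding gram_graph_iso_def
    by (auto intro!: exI[of _ "g \<circ> f"] bij_betw_trans simp: bij_betw_apply)
qed

lemma gram_graph_iso_cyclic_products:
  assumes "(P, Q) \<in> gram_graph_iso B"
  shows "cyclic_products P B \<subseteq> cyclic_products Q B"
proof
  from assms obtain f where f: "bij_betw f P Q" "\<And>x y. x \<in> P \<Longrightarrow> y \<in> P \<Longrightarrow> B (f x) (f y) = B x y"
    unfolding gram_graph_iso_def by blast
  fix c assume "c \<in> cyclic_products P B"
  then obtain xs where xs: "xs \<noteq> []" "set xs \<subseteq> P"
    "c = (\<Prod>k<length xs. B (xs ! k) (xs ! (Suc k mod length xs)))"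
    unfolding cyclic_products_def by blast
  have nth: "xs ! i \<in> P" if "i < length xs" for i using xs(2) that nth_mem by blast
  have "c = (\<Prod>k<length (map f xs). B (map f xs ! k) (map f xs ! (Suc k mod length (map f xs))))"
    unfolding xs(3) using xs(1) by (intro prod.cong) (auto simp: f(2) nth)
  moreover have "map f xs \<noteq> []" "set (map f xs) \<subseteq> Q" using xs f(1) by (auto simp: bij_betw_def)
  ultimately show "c \<in> cyclic_products Q B" unfolding cyclic_products_def by blast
qed

lemma finite_image_factor:
  assumes "finite (g ` A)" "\<And>x y. x \<in> A \<Longrightarrow> y \<in> A \<Longrightarrow> g x = g y \<Longrightarrow> f x = f y"
  shows "finite (f ` A)"
proof -
  have "f ` A \<subseteq> (\<lambda>z. f (SOME x. x \<in> A \<and> g x = z)) ` (g ` A)"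
  proof
    fix y assume "y \<in> f ` A"
    then obtain x where x: "x \<in> A" "y = f x" by blast
    let ?x = "SOME x'. x' \<in> A \<and> g x' = g x"
    have "?x \<in> A \<and> g ?x = g x" by (rule someI[of _ x]) (use x in simp)
    hence "f ?x = y" using assms(2) x by blast
    thus "y \<in> (\<lambda>z. f (SOME x. x \<in> A \<and> g x = z)) ` (g ` A)" using x by blast
  qed
  thus ?thesis using assms(1) by (meson finite_imageI finite_subset)
qed

text \<open>Finitely many possible entries and a bounded number of vertices leave finitely many graphs.\<close>

lemma finite_gram_graphs:
  fixes B :: "'v \<Rightarrow> 'v \<Rightarrow> real"
  assumes W: "finite W" and entries: "\<And>P x y. P \<in> S \<Longrightarrow> x \<in> P \<Longrightarrow> y \<in> P \<Longrightarrow> B x y \<in> W"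
    and card: "\<And>P. P \<in> S \<Longrightarrow> finite P \<and> card P \<le> n"
  shows "finite (S // gram_graph_iso B)" and "finite (ground_fields B S)"
proof -
  define enum :: "'v set \<Rightarrow> 'v list" where "enum = (\<lambda>P. SOME xs. set xs = P \<and> distinct xs)"
  have enum: "set (enum P) = P" "distinct (enum P)" if "P \<in> S" for P
  proof -
    have "set (enum P) = P \<and> distinct (enum P)"
      unfolding enum_def by (rule someI_ex) (use card[OF that] finite_distinct_list in blast)
    thus "set (enum P) = P" "distinct (enum P)" by auto
  qed
  let ?g = "\<lambda>P. gram_list B (enum P)"
  have "?g ` S \<subseteq> {A. set A \<subseteq> {r. set r \<subseteq> W \<and> length r \<le> n} \<and> length A \<le> n}"
  proof (intro subsetI CollectI)
    fix A assume "A \<in> ?g ` S"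
    then obtain P where P: "P \<in> S" "A = ?g P" by blast
    have "length (enum P) \<le> n" using enum[OF P(1)] card[OF P(1)] distinct_card by metis
    thus "set A \<subseteq> {r. set r \<subseteq> W \<and> length r \<le> n} \<and> length A \<le> n"
      using entries[OF P(1)] enum(1)[OF P(1)] unfolding P(2) gram_list_def by auto
  qed
  hence fin: "finite (?g ` S)"
    by (rule finite_subset) (intro finite_lists_length_le W)
  have iso: "(P, Q) \<in> gram_graph_iso B" if PQ: "P \<in> S" "Q \<in> S" "?g P = ?g Q" for P Q
  proof -
    obtain f where f: "bij_betw f (set (enum P)) (set (enum Q))"
      "\<And>x y. x \<in> set (enum P) \<Longrightarrow> y \<in> set (enum P) \<Longrightarrow> B (f x) (f y) = B x y"
      by (rule gram_list_eq_imp_iso[OF enum(2)[OF PQ(1)] enum(2)[OF PQ(2)] PQ(3)]) (rule that)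
    thus ?thesis
      unfolding gram_graph_iso_def enum(1)[OF PQ(1)] enum(1)[OF PQ(2)] by blast
  qed
  have "finite ((\<lambda>P. gram_graph_iso B `` {P}) ` S)"
  proof (rule finite_image_factor[OF fin])
    fix P Q assume "P \<in> S" "Q \<in> S" "?g P = ?g Q"
    from iso[OF this] show "gram_graph_iso B `` {P} = gram_graph_iso B `` {Q}"
      by (blast intro: gram_graph_iso_sym gram_graph_iso_trans)
  qed
  moreover have "S // gram_graph_iso B = (\<lambda>P. gram_graph_iso B `` {P}) ` S"
    unfolding quotient_def by blast
  ultimately show "finite (S // gram_graph_iso B)" by simp
  show "finite (ground_fields B S)"
    unfolding ground_fields_def
  proof (rule finite_image_factor[OF fin])
    fix P Q assume "P \<in> S" "Q \<in> S" "?g P = ?g Q"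
    from iso[OF this] have "cyclic_products P B = cyclic_products Q B"
      using gram_graph_iso_cyclic_products[of P Q B] gram_graph_iso_cyclic_products[of Q P B]
        gram_graph_iso_sym[of P Q B] by simp
    thus "ground_field P B = ground_field Q B" unfolding ground_field_def by simp
  qed
qed

text \<open>
  \<open>P\<close> is the set of normals of a V-arithmetic chamber of minimality \<open>14\<close>, has at most seven elements, and
  contains \<open>u\<close>, \<open>v\<close>, \<open>w\<close> such that \<open>u\<close> is joined to
  \<open>v\<close> by an edge of weight more than \<open>2\<close> and to \<open>w\<close> by an edge of weight \<open>2 cos (\<pi>/m)\<close>, while \<open>v\<close>
  and \<open>w\<close> are not joined.
\<close>

definition star_chamber :: "('v::euclidean_space \<Rightarrow> 'v \<Rightarrow> real) \<Rightarrow> 'v set \<Rightarrow> bool" where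
  "star_chamber B P \<longleftrightarrow> V_arithmetic P B \<and> has_minimality 14 P B \<and> card P \<le> 7 \<and>
     (\<exists>L M. fundamental_chamber B L M \<and> P = normals B M) \<and>
     (\<exists>u\<in>P. \<exists>v\<in>P. \<exists>w\<in>P. \<exists>m\<ge>3. 2 < B u v \<and> B v w = 0 \<and> B u w = 2 * cos (pi / real m))"

lemma star_chambers_finite:
  assumes sym: "\<And>x y. B x y = B y x" and S: "\<And>P. P \<in> S \<Longrightarrow> star_chamber B P"
  shows "finite (S // gram_graph_iso B)" "finite (ground_fields B S)"
    and "\<forall>K \<in> ground_fields B S. field_degree K \<le> 42"
proof -
  have main: "field_degree (ground_field P B) \<le> 42 \<and> (\<forall>x\<in>P. \<forall>y\<in>P. B x y \<in> gram_entries)"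
    if "P \<in> S" for P
  proof -
    note * = S[OF that, unfolded star_chamber_def]
    from * obtain L M where M: "fundamental_chamber B L M" "P = normals B M" by blast
    from * obtain u v w and m :: nat where uvw: "u \<in> P" "v \<in> P" "w \<in> P" "3 \<le> m" "2 < B u v"
      "B v w = 0" "B u w = 2 * cos (pi / real m)" by blast
    have diag: "B x x = -2" if "x \<in> P" for x using that M(2) unfolding normals_def by blast
    have off: "0 \<le> B x y" if "x \<in> P" "y \<in> P" "x \<noteq> y" for x y
    proof -
      from that M consider k :: nat where "k \<ge> 2" "B x y = 2 * cos (pi / real k)" | "B x y \<ge> 2"
        unfolding fundamental_chamber_def by blast
      thus ?thesis
      proof cases
        case 1
        thus ?thesis using cos_pi_div_nonneg[of k] by simp
      qed simp
    qed
    show ?thesis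
      using star_graph_bounds[OF _ _ sym diag off uvw(1-3,5,6,4,7)] * by blast
  qed
  have fin: "finite P \<and> card P \<le> 7" if "P \<in> S" for P
    using S[OF that] unfolding star_chamber_def V_arithmetic_def by blast
  show "finite (S // gram_graph_iso B)" "finite (ground_fields B S)"
    using finite_gram_graphs[of gram_entries S B 7] finite_gram_entries main fin by blast+
  show "\<forall>K \<in> ground_fields B S. field_degree K \<le> 42"
    unfolding ground_fields_def using main by blast
qed

section \<open>The five families of pentagon graphs\<close>

lemma card_pentagon_union: "finite E \<Longrightarrow> card E \<le> 2 \<Longrightarrow> card (d ` {1..5::nat} \<union> E) \<le> 7"
  using card_Un_le[of "d ` {1..5}" E] card_image_le[of "{1..5::nat}" d] by simp

lemma chamber_with_pentagonD:
  assumes "chamber_with_pentagon B P d E \<beta>"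
  shows "P = d ` {1..5} \<union> E" "\<exists>L M. fundamental_chamber B L M \<and> P = normals B M"
  using assms unfolding chamber_with_pentagon_def by blast+

text \<open>
  The centre and the end of the heavy edge are \<open>\<delta>\<^sub>4, \<delta>\<^sub>1\<close> for the first family, \<open>\<delta>\<^sub>1, \<delta>\<^sub>3\<close> for the second and
  the fourth, and \<open>\<delta>\<^sub>1, \<delta>\<^sub>4\<close> for the third and the fifth, where \<open>\<delta>\<^sub>3\<close> is joined to the end \<open>w\<close> of the
  other edge.
\<close>

lemma Gamma_star_chamber:
  assumes sym: "\<And>x y. B x y = B y x"
  shows "P \<in> Gamma6_1 B 14 \<Longrightarrow> star_chamber B P" "P \<in> Gamma6_2 B 14 \<Longrightarrow> star_chamber B P"
    "P \<in> Gamma6_3 B 14 \<Longrightarrow> star_chamber B P" "P \<in> Gamma7_1 B 14 \<Longrightarrow> star_chamber B P"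
    "P \<in> Gamma7_2 B 14 \<Longrightarrow> star_chamber B P"
proof -
  have star: "star_chamber B P"
    if "V_arithmetic P B" "has_minimality 14 P B" "chamber_with_pentagon B P d E \<beta>" "finite E" "card E \<le> 2"
      "i \<in> {1..5}" "j \<in> {1..5}" "w \<in> E" "m \<ge> 3" "2 < B (d i) (d j)" "B (d j) w = 0"
      "B (d i) w = 2 * cos (pi / real m)"
    for d E \<beta> i j w and m :: nat
    unfolding star_chamber_def
    using that chamber_with_pentagonD[OF that(3)] card_pentagon_union[OF that(4,5), of d] by blast
  have card2: "card {e1, e2} \<le> 2" for e1 e2 :: 'a by (simp add: card_insert_if)
  show "star_chamber B P" if P: "P \<in> Gamma6_1 B 14"
  proof -
    from P obtain d e and k m :: nat where *: "V_arithmetic P B" "has_minimality 14 P B"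
      "chamber_with_pentagon B P d {e} (\<lambda>i. if i = 1 then pi / real k else pi / 2)" "m \<ge> 3"
      "2 < B (d 1) (d 4)" "B (d 1) e = 0" "B (d 4) e = 2 * cos (pi / real m)"
      unfolding Gamma6_1_def pentagon_products_def by blast
    show ?thesis by (rule star[OF *(1-3), of 4 1 e m]) (use * sym in auto)
  qed
  show "star_chamber B P" if P: "P \<in> Gamma6_2 B 14"
  proof -
    from P obtain d e and m :: nat where *: "V_arithmetic P B" "has_minimality 14 P B"
      "chamber_with_pentagon B P d {e} (\<lambda>i. pi / 2)" "m \<ge> 3"
      "2 < B (d 1) (d 3)" "B (d 3) e = 0" "B (d 1) e = 2 * cos (pi / real m)"
      unfolding Gamma6_2_def pentagon_products_def by blast
    show ?thesis by (rule star[OF *(1-3), of 1 3 e m]) (use * in auto)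
  qed
  show "star_chamber B P" if P: "P \<in> Gamma6_3 B 14"
  proof -
    from P obtain d e and m :: nat where *: "V_arithmetic P B" "has_minimality 14 P B"
      "chamber_with_pentagon B P d {e} (\<lambda>i. pi / 2)" "m \<ge> 3"
      "2 < B (d 1) (d 4)" "B (d 4) e = 0" "B (d 1) e = 2 * cos (pi / real m)"
      unfolding Gamma6_3_def pentagon_products_def by blast
    show ?thesis by (rule star[OF *(1-3), of 1 4 e m]) (use * in auto)
  qed
  show "star_chamber B P" if P: "P \<in> Gamma7_1 B 14"
  proof -
    from P obtain d e1 e2 and m :: nat where *: "V_arithmetic P B" "has_minimality 14 P B"
      "chamber_with_pentagon B P d {e1, e2} (\<lambda>i. pi / 2)" "m \<ge> 3"
      "2 < B (d 1) (d 3)" "B (d 3) e1 = 0" "B (d 1) e1 = 2 * cos (pi / real m)"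
      unfolding Gamma7_1_def pentagon_products_def by blast
    show ?thesis by (rule star[OF *(1-3), of 1 3 e1 m]) (use * card2 in auto)
  qed
  show "star_chamber B P" if P: "P \<in> Gamma7_2 B 14"
  proof -
    from P obtain d e1 e2 and m :: nat where *: "V_arithmetic P B" "has_minimality 14 P B"
      "chamber_with_pentagon B P d {e1, e2} (\<lambda>i. pi / 2)" "m \<ge> 3"
      "2 < B (d 1) (d 4)" "B (d 4) e1 = 0" "B (d 1) e1 = 2 * cos (pi / real m)"
      unfolding Gamma7_2_def pentagon_products_def by blast
    show ?thesis by (rule star[OF *(1-3), of 1 4 e1 m]) (use * card2 in auto)
  qed
qed

theorem theorem2p5:
  fixes B3 :: "'a::euclidean_space \<Rightarrow> 'a \<Rightarrow> real"
    and B4 :: "'b::euclidean_space \<Rightarrow> 'b \<Rightarrow> real"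
  assumes "lorentzian_form 3 B3" and "lorentzian_form 4 B4"
  shows "finite (Gamma6_1 B3 14 // gram_graph_iso B3) \<and>
     finite (Gamma6_2 B3 14 // gram_graph_iso B3) \<and>
     finite (Gamma6_3 B3 14 // gram_graph_iso B3) \<and>
     finite (Gamma7_1 B4 14 // gram_graph_iso B4) \<and>
     finite (Gamma7_2 B4 14 // gram_graph_iso B4) \<and>
     finite (ground_fields B3 (Gamma6_1 B3 14)) \<and>
     finite (ground_fields B3 (Gamma6_2 B3 14)) \<and>
     finite (ground_fields B3 (Gamma6_3 B3 14)) \<and>
     finite (ground_fields B4 (Gamma7_1 B4 14)) \<and>
     finite (ground_fields B4 (Gamma7_2 B4 14)) \<and>
     (\<forall>K \<in> ground_fields B3 (Gamma6_1 B3 14). field_degree K \<le> 56) \<and>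
     (\<forall>K \<in> ground_fields B3 (Gamma6_2 B3 14). field_degree K \<le> 75) \<and>
     (\<forall>K \<in> ground_fields B3 (Gamma6_3 B3 14). field_degree K \<le> 138) \<and>
     (\<forall>K \<in> ground_fields B4 (Gamma7_1 B4 14). field_degree K \<le> 42) \<and>
     (\<forall>K \<in> ground_fields B4 (Gamma7_2 B4 14). field_degree K \<le> 138)"
proof -
  have sym3: "\<And>x y. B3 x y = B3 y x" and sym4: "\<And>x y. B4 x y = B4 y x"
    using assms unfolding lorentzian_form_def by blast+
  note F61 = star_chambers_finite[where S = "Gamma6_1 B3 14", OF sym3 Gamma_star_chamber(1)[OF sym3]]
    and F62 = star_chambers_finite[where S = "Gamma6_2 B3 14", OF sym3 Gamma_star_chamber(2)[OF sym3]]
    and F63 = star_chambers_finite[where S = "Gamma6_3 B3 14", OF sym3 Gamma_star_chamber(3)[OF sym3]]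
    and F71 = star_chambers_finite[where S = "Gamma7_1 B4 14", OF sym4 Gamma_star_chamber(4)[OF sym4]]
    and F72 = star_chambers_finite[where S = "Gamma7_2 B4 14", OF sym4 Gamma_star_chamber(5)[OF sym4]]
  have weaken: "42 \<le> n \<Longrightarrow> \<forall>K\<in>A. field_degree K \<le> n" if "\<forall>K\<in>A. field_degree K \<le> 42" for A n
    using that by fastforce
  show ?thesis
    by (intro conjI F61(1,2) F62(1,2) F63(1,2) F71 F72(1,2)
        weaken[OF F61(3)] weaken[OF F62(3)] weaken[OF F63(3)] weaken[OF F72(3)]) simp_all
qed

end
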